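(* Let $s\ge1$, $q\in[0,1]$, and let $q_n\in[0,1]$ be random with $q_n=q+o_{f_{0,n}}(1)$. Let $\alpha_n$ be a positive sequence with $\frac1n\ll\alpha_n\ll1$, and let $\hat\alpha_n,\hat\gamma_n$ be positive data-dependent sequences such that, for all $\epsilon>0$ and $B>0$, $$\mathbb P_{f_{0,n}}\Big(1-\epsilon<\frac{\hat\alpha_n}{\alpha_n}<1+\epsilon\Big)\to1,\qquad \mathbb P_{f_{0,n}}(\hat\gamma_n>B)\to1.$$ Consider the mixed posterior $\pi_{n,\hat\alpha_n^{\mathrm{mix}}}(\theta|X^n)=q_n\,\pi_{n,\hat\alpha_n}(\theta|X^n)+(1-q_n)\,\pi_{n,\hat\gamma_n}(\theta|X^n)$. Assume (A0), (A1), (A2), (A3), (A3') and Conditions 1 and 2 (stated in the context), that $\pi(\theta)\le\kappa$ for all $\theta$ for some $\kappa>0$, that $\theta\mapsto f_n(X^n|\theta)$ is continuous at $\hat\theta$, and that $\int\|\theta\|_2^s\,\pi(\theta)\,d\theta<\infty$. Assume further that $\int\|\theta\|_2^m\,\pi(\theta)\,d\theta<\infty$ for some $m>s$. Then, with $\phi_n=\phi\big(\cdot\,|\,\hat\theta,\frac1{\alpha_nn}V_{\theta^*}^{-1}\big)$, $$d_{W_s}\Big(\pi_{n,\hat\alpha_n^{\mathrm{mix}}},\ q\,\phi_n+(1-q)\,\delta_{\hat\theta}\Big)\to0\quad\text{in }f_{0,n}\text{-probability.}$$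
   Context: Setting. For each $n$, $X^n=(X_1,\dots,X_n)\in\mathcal X^n$ ($\mathcal X\subset\mathbb R^d$) is a random sample with true density $f_{0,n}$; $\mathbb P_{f_{0,n}}$ is the corresponding probability. $\{f_n(\cdot|\theta):\theta\in\Theta\subset\mathbb R^p\}$ is a parametric family of densities, possibly misspecified. $\hat\theta=\arg\max_\theta f_n(X^n|\theta)$ is the MLE and $\pi$ is a prior density. For $\alpha>0$ (deterministic or data-dependent) the $\alpha$-posterior has density $\pi_{n,\alpha}(\theta|X^n)=f_n(X^n|\theta)^\alpha\pi(\theta)/\int_{\mathbb R^p}f_n(X^n|\theta)^\alpha\pi(\theta)\,d\theta$; all these posteriors are assumed proper. Integrands in $\theta$ are understood as zero outside $\Theta$. $\phi(\cdot|\mu,\Sigma)$ is the multivariate normal density (also used for the distribution); $\delta_{\hat\theta}$ is the point mass at $\hat\theta$. $Y_n=o_{f_{0,n}}(1)$ means $Y_n\to0$ in $\mathbb P_{f_{0,n}}$-probability. $a_n\ll b_n$ means $a_n/b_n\to0$. $d_{W_s}(\mu,\nu)=\big(\inf_{\gamma\in\Gamma(\mu,\nu)}\int\|x-y\|_2^s\,d\gamma(x,y)\big)^{1/s}$ with $\Gamma(\mu,\nu)$ the couplings of $\mu,\nu$. $B_v(r)$, $\bar B_v(r)$ are open and closed Euclidean balls. Assumptions; in (A2), (A3) $\alpha_n$ denotes an arbitrary positive sequence with $\frac1n\ll\alpha_n\ll1$. (A0) The MLE $\hat\theta$ is unique and there exists $\theta^*\in\Theta$, with $\Theta$ an open subset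 of $\mathbb R^p$, such that $\hat\theta\to\theta^*$ in $f_{0,n}$-probability and $\sqrt n(\hat\theta-\theta^* )$ is asymptotically normal. (A1) The prior $\pi$ is continuous and positive in an open ball around $\theta^*$. (A2) Let $\Delta_{n,\theta^*}=\sqrt n(\hat\theta-\theta^* )$. There exists a positive definite matrix $V_{\theta^*}$ such that $\sup_{h\in\bar B_0(r)}|R_n(h)|\to0$ in $f_{0,n}$-probability for any $r>0$, where $$R_n(h)=\alpha_n\Big[\log f_n\Big(X^n\Big|\theta^*+\tfrac{h}{\sqrt{\alpha_n n}}\Big)-\log f_n(X^n|\theta^* )\Big]-\sqrt{\alpha_n}\,h^\top V_{\theta^*}\Delta_{n,\theta^*}+\tfrac12h^\top V_{\theta^*}h.$$ (A3) For all $\epsilon>0$ and $k_0\ge0$ there exist a constant $M=M(k_0,\epsilon)<\infty$ and an integer $N=N(k_0,\epsilon)$ such that for $\alpha_n n\ge N$, $\mathbb P_{f_{0,n}}\big(\int_{\mathbb R^p}\|\sqrt{\alpha_n n}(\theta-\theta^* )\|_2^{k_0}\pi_{n,\alpha_n}(\theta|X^n)d\theta>M\big)<\epsilon$. (A3') For all $\epsilon>0$ and $\delta'>0$ there exists $c=c(\epsilon,\delta')>0$ such that for $n$ sufficiently large $$\mathbb P_{f_{0,n}}\Big(\sup_{\theta\in B_{\hat\theta}(\delta')^{\mathsf c}}\Big\{\tfrac1n\log f_n(X^n|\theta)-\tfrac1n\log f_n(X^n|\hat\theta)\Big\}>-c\Big)<\epsilon.$$ Condition 1. There are constants $L,c_0,c_1>0$,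 $c_2\ge0$, some $r>e^{c_2/c_0}/c_1$, and a function $\gamma:[0,\infty)\to[0,\infty)$ with $\gamma(v)\ge c_0\log(1+c_1v)-c_2$ for $v\ge r$, such that with $f_{0,n}$-probability tending to one, uniformly over $\theta\in B_{\theta^*}(r)^{\mathsf c}$, $\log f_n(X^n|\theta)-\log f_n(X^n|\theta^* )\le-Ln\gamma(\|\theta-\theta^*\|_2)$. Condition 2. For the $c_0,c_1,c_2,r$ of Condition 1 there exist constants $c_3=c_3(r)>0$, $c_4=c_4(r)>0$ such that with $f_{0,n}$-probability tending to one, uniformly over $\theta\in B_{\hat\theta}(2r)$, $-nc_3\|\theta-\hat\theta\|_2^2\le\log f_n(X^n|\theta)-\log f_n(X^n|\hat\theta)\le-nc_4\|\theta-\hat\theta\|_2^2$. *)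

theory Defs
  imports "HOL-Probability.Probability"
begin

text \<open>
  Many of the events below involve suprema over uncountable sets, infima over couplings, or
  uncountable intersections, and need not be measurable.  Smallness of probabilities is therefore
  expressed with the outer measure, which is the ordinary probability on measurable events
  (\<^const>\<open>emeasure\<close> would silently return 0 on non-measurable ones).
\<close>

definition outer_prob :: "'w measure \<Rightarrow> ('w \<Rightarrow> bool) \<Rightarrow> ennreal" where
  "outer_prob M P = outer_measure_of M {\<omega> \<in> space M. P \<omega>}"

definition tends_to_zero_in_prob :: "(nat \<Rightarrow> 'w measure) \<Rightarrow> (nat \<Rightarrow> 'w \<Rightarrow> ereal) \<Rightarrow> bool" where
  "tends_to_zero_in_prob M Y \<longleftrightarrow>
     (\<forall>\<epsilon>>0::real. (\<lambda>n. outer_prob (M n) (\<lambda>\<omega>. \<bar>Y n \<omega>\<bar> > ereal \<epsilon>)) \<longlonglongrightarrow> 0)"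

definition with_prob_tending_to_one :: "(nat \<Rightarrow> 'w measure) \<Rightarrow> (nat \<Rightarrow> 'w \<Rightarrow> bool) \<Rightarrow> bool" where
  "with_prob_tending_to_one M E \<longleftrightarrow> (\<lambda>n. outer_prob (M n) (\<lambda>\<omega>. \<not> E n \<omega>)) \<longlonglongrightarrow> 0"

definition converges_in_distribution ::
    "(nat \<Rightarrow> 'w measure) \<Rightarrow> (nat \<Rightarrow> 'w \<Rightarrow> 'b::euclidean_space) \<Rightarrow> 'b measure \<Rightarrow> bool" where
  "converges_in_distribution M Y N \<longleftrightarrow>
     (\<forall>g :: 'b \<Rightarrow> real. continuous_on UNIV g \<longrightarrow> bounded (range g) \<longrightarrow>
        (\<lambda>n. \<integral>\<omega>. g (Y n \<omega>) \<partial>M n) \<longlonglongrightarrow> (\<integral>y. g y \<partial>N))"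

definition positive_definite :: "real^'p^'p \<Rightarrow> bool" where
  "positive_definite A \<longleftrightarrow> transpose A = A \<and> (\<forall>h. h \<noteq> 0 \<longrightarrow> h \<bullet> (A *v h) > 0)"

definition mv_normal_density :: "real^'p \<Rightarrow> real^'p^'p \<Rightarrow> real^'p \<Rightarrow> real" where
  "mv_normal_density \<mu> \<Sigma> x =
     exp (- (1/2) * ((x - \<mu>) \<bullet> (matrix_inv \<Sigma> *v (x - \<mu>)))) / sqrt ((2 * pi) ^ CARD('p) * det \<Sigma>)"

definition mv_normal :: "real^'p \<Rightarrow> real^'p^'p \<Rightarrow> (real^'p) measure" where
  "mv_normal \<mu> \<Sigma> = density lborel (\<lambda>x. ennreal (mv_normal_density \<mu> \<Sigma> x))"

definition mixture :: "real \<Rightarrow> 'b measure \<Rightarrow> 'b measure \<Rightarrow> 'b measure" where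
  "mixture p \<mu> \<nu> = measure_of (space \<mu>) (sets \<mu>)
     (\<lambda>A. ennreal p * emeasure \<mu> A + ennreal (1 - p) * emeasure \<nu> A)"

lemma sets_mixture [simp]: "sets (mixture p \<mu> \<nu>) = sets \<mu>"
  and space_mixture [simp]: "space (mixture p \<mu> \<nu>) = space \<mu>"
  by (simp_all add: mixture_def)

lemma emeasure_mixture:
  fixes \<mu> \<nu> :: "'b measure"
  assumes "sets \<nu> = sets \<mu>" "A \<in> sets \<mu>"
  shows "emeasure (mixture p \<mu> \<nu>) A = ennreal p * emeasure \<mu> A + ennreal (1 - p) * emeasure \<nu> A"
proof (rule emeasure_measure_of[OF mixture_def])
  let ?m = "\<lambda>A. ennreal p * emeasure \<mu> A + ennreal (1 - p) * emeasure \<nu> A"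
  show "sets \<mu> \<subseteq> Pow (space \<mu>)" by (rule sets.space_closed)
  show "A \<in> sets (mixture p \<mu> \<nu>)" using assms by simp
  show "positive (sets (mixture p \<mu> \<nu>)) ?m" by (simp add: positive_def)
  show "countably_additive (sets (mixture p \<mu> \<nu>)) ?m"
  proof (rule countably_additiveI)
    fix F :: "nat \<Rightarrow> 'b set"
    assume F: "range F \<subseteq> sets (mixture p \<mu> \<nu>)" "disjoint_family F"
    have "(\<Sum>i. ?m (F i)) =
        ennreal p * (\<Sum>i. emeasure \<mu> (F i)) + ennreal (1 - p) * (\<Sum>i. emeasure \<nu> (F i))"
      by (simp add: suminf_add[symmetric])
    then show "(\<Sum>i. ?m (F i)) = ?m (\<Union>i. F i)"
      using F assms by (simp add: suminf_emeasure)
  qed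
qed

definition couplings :: "'b measure \<Rightarrow> 'b measure \<Rightarrow> ('b \<times> 'b) measure set" where
  "couplings \<mu> \<nu> =
     {\<gamma>. sets \<gamma> = sets (\<mu> \<Otimes>\<^sub>M \<nu>) \<and> distr \<gamma> \<mu> fst = \<mu> \<and> distr \<gamma> \<nu> snd = \<nu>}"

text \<open>Extended-valued, because \<^const>\<open>enn2real\<close> would turn an infinite transport cost into 0.\<close>

definition wasserstein :: "real \<Rightarrow> 'b::euclidean_space measure \<Rightarrow> 'b measure \<Rightarrow> ereal" where
  "wasserstein s \<mu> \<nu> =
     (let I = (INF \<gamma> \<in> couplings \<mu> \<nu>. \<integral>\<^sup>+ z. ennreal (norm (fst z - snd z) powr s) \<partial>\<gamma>)
      in if I = \<infinity> then \<infinity> else ereal (enn2real I powr (1 / s)))"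

definition sample_measure :: "'d measure \<Rightarrow> nat \<Rightarrow> (nat \<Rightarrow> 'd) measure" where
  "sample_measure \<nu> n = (\<Pi>\<^sub>M i\<in>{..<n}. \<nu>)"

definition is_density :: "'b measure \<Rightarrow> ('b \<Rightarrow> real) \<Rightarrow> bool" where
  "is_density N g \<longleftrightarrow> g \<in> borel_measurable N \<and> (\<forall>x\<in>space N. 0 \<le> g x) \<and> (\<integral>\<^sup>+ x. ennreal (g x) \<partial>N) = 1"

text \<open>
  In everything that follows \<open>lik n \<omega> \<theta>\<close> is the likelihood \<open>f\<^sub>n(X\<^sup>n(\<omega>) | \<theta>)\<close> and
  \<open>mle n \<omega>\<close> is the estimator evaluated at \<open>X\<^sup>n(\<omega>)\<close>; only \<open>\<theta> \<in> \<Theta>\<close> is meaningful.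
  Densities may vanish, so the logarithm has to take the value \<open>-\<infinity>\<close> at 0
  (the library has \<open>ln 0 = 0\<close>).  A difference of two such logarithms is \<open>\<infinity>\<close> when both
  are \<open>-\<infinity>\<close>.
\<close>

definition elog :: "real \<Rightarrow> ereal" where
  "elog y = (if y \<le> 0 then -\<infinity> else ereal (ln y))"

text \<open>\<open>l\<close> is the likelihood \<open>\<theta> \<mapsto> f\<^sub>n(X\<^sup>n | \<theta>)\<close> at a fixed sample.\<close>

definition tempered :: "('b \<Rightarrow> real) \<Rightarrow> 'b set \<Rightarrow> ('b \<Rightarrow> real) \<Rightarrow> real \<Rightarrow> 'b \<Rightarrow> real" where
  "tempered \<pi> \<Theta> l a \<theta> = indicator \<Theta> \<theta> * (l \<theta> powr a * \<pi> \<theta>)"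

definition proper_posterior ::
    "('b::euclidean_space \<Rightarrow> real) \<Rightarrow> 'b set \<Rightarrow> ('b \<Rightarrow> real) \<Rightarrow> real \<Rightarrow> bool" where
  "proper_posterior \<pi> \<Theta> l a \<longleftrightarrow>
     integrable lborel (tempered \<pi> \<Theta> l a) \<and> (\<integral>\<theta>. tempered \<pi> \<Theta> l a \<theta> \<partial>lborel) > 0"

definition posterior_density ::
    "('b::euclidean_space \<Rightarrow> real) \<Rightarrow> 'b set \<Rightarrow> ('b \<Rightarrow> real) \<Rightarrow> real \<Rightarrow> 'b \<Rightarrow> real" where
  "posterior_density \<pi> \<Theta> l a \<theta> =
     tempered \<pi> \<Theta> l a \<theta> / (\<integral>\<theta>'. tempered \<pi> \<Theta> l a \<theta>' \<partial>lborel)"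

definition posterior ::
    "('b::euclidean_space \<Rightarrow> real) \<Rightarrow> 'b set \<Rightarrow> ('b \<Rightarrow> real) \<Rightarrow> real \<Rightarrow> 'b measure" where
  "posterior \<pi> \<Theta> l a = density lborel (\<lambda>\<theta>. ennreal (posterior_density \<pi> \<Theta> l a \<theta>))"

definition tempering_sequence :: "(nat \<Rightarrow> real) \<Rightarrow> bool" where
  "tempering_sequence \<alpha> \<longleftrightarrow>
     (\<forall>n\<ge>1. \<alpha> n > 0) \<and> (\<lambda>n. (1 / real n) / \<alpha> n) \<longlonglongrightarrow> 0 \<and> \<alpha> \<longlonglongrightarrow> 0"

definition is_unique_MLE ::
    "(nat \<Rightarrow> 'w measure) \<Rightarrow> 'b set \<Rightarrow> (nat \<Rightarrow> 'w \<Rightarrow> 'b \<Rightarrow> real) \<Rightarrow> (nat \<Rightarrow> 'w \<Rightarrow> 'b) \<Rightarrow> bool" where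
  "is_unique_MLE M \<Theta> lik mle \<longleftrightarrow>
     (\<forall>n\<ge>1. AE \<omega> in M n. \<forall>\<theta>. is_arg_max (lik n \<omega>) (\<lambda>t. t \<in> \<Theta>) \<theta> \<longleftrightarrow> \<theta> = mle n \<omega>)"

definition assumption_A0 ::
    "(nat \<Rightarrow> 'w measure) \<Rightarrow> (real^'p) set \<Rightarrow> (nat \<Rightarrow> 'w \<Rightarrow> real^'p \<Rightarrow> real) \<Rightarrow>
     (nat \<Rightarrow> 'w \<Rightarrow> real^'p) \<Rightarrow> real^'p \<Rightarrow> bool" where
  "assumption_A0 M \<Theta> lik mle \<theta>\<^sub>0 \<longleftrightarrow>
     open \<Theta> \<and> \<theta>\<^sub>0 \<in> \<Theta> \<and> is_unique_MLE M \<Theta> lik mle \<and>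
     tends_to_zero_in_prob M (\<lambda>n \<omega>. ereal (norm (mle n \<omega> - \<theta>\<^sub>0))) \<and>
     (\<exists>\<Sigma>. positive_definite \<Sigma> \<and>
        converges_in_distribution M (\<lambda>n \<omega>. sqrt (real n) *\<^sub>R (mle n \<omega> - \<theta>\<^sub>0)) (mv_normal 0 \<Sigma>))"

definition assumption_A1 :: "('b::metric_space \<Rightarrow> real) \<Rightarrow> 'b \<Rightarrow> bool" where
  "assumption_A1 \<pi> \<theta>\<^sub>0 \<longleftrightarrow>
     (\<exists>\<rho>>0. continuous_on (ball \<theta>\<^sub>0 \<rho>) \<pi> \<and> (\<forall>\<theta>\<in>ball \<theta>\<^sub>0 \<rho>. \<pi> \<theta> > 0))"

text \<open>The likelihood counts as zero outside \<open>\<Theta>\<close>.  Since \<open>\<Theta>\<close> is open and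
  \<open>\<alpha> n * n\<close> tends to infinity, this is irrelevant for large \<open>n\<close>.\<close>

definition LAN_remainder ::
    "(real^'p) set \<Rightarrow> (nat \<Rightarrow> 'w \<Rightarrow> real^'p \<Rightarrow> real) \<Rightarrow> (nat \<Rightarrow> 'w \<Rightarrow> real^'p) \<Rightarrow> real^'p \<Rightarrow>
     real^'p^'p \<Rightarrow> (nat \<Rightarrow> real) \<Rightarrow> nat \<Rightarrow> 'w \<Rightarrow> real^'p \<Rightarrow> ereal" where
  "LAN_remainder \<Theta> lik mle \<theta>\<^sub>0 V \<alpha> n \<omega> h =
     (let \<theta> = \<theta>\<^sub>0 + h /\<^sub>R sqrt (\<alpha> n * real n);
          \<Delta> = sqrt (real n) *\<^sub>R (mle n \<omega> - \<theta>\<^sub>0)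
      in ereal (\<alpha> n) * (elog (indicator \<Theta> \<theta> * lik n \<omega> \<theta>) - elog (lik n \<omega> \<theta>\<^sub>0))
         - ereal (sqrt (\<alpha> n) * (h \<bullet> (V *v \<Delta>))) + ereal (1/2 * (h \<bullet> (V *v h))))"

definition assumption_A2 ::
    "(nat \<Rightarrow> 'w measure) \<Rightarrow> (real^'p) set \<Rightarrow> (nat \<Rightarrow> 'w \<Rightarrow> real^'p \<Rightarrow> real) \<Rightarrow>
     (nat \<Rightarrow> 'w \<Rightarrow> real^'p) \<Rightarrow> real^'p \<Rightarrow> real^'p^'p \<Rightarrow> bool" where
  "assumption_A2 M \<Theta> lik mle \<theta>\<^sub>0 V \<longleftrightarrow>
     positive_definite V \<and>
     (\<forall>\<alpha>. tempering_sequence \<alpha> \<longrightarrow> (\<forall>r>0.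
        tends_to_zero_in_prob M (\<lambda>n \<omega>. SUP h\<in>cball 0 r. \<bar>LAN_remainder \<Theta> lik mle \<theta>\<^sub>0 V \<alpha> n \<omega> h\<bar>)))"

definition assumption_A3 ::
    "(nat \<Rightarrow> 'w measure) \<Rightarrow> ('b::euclidean_space \<Rightarrow> real) \<Rightarrow> 'b set \<Rightarrow> (nat \<Rightarrow> 'w \<Rightarrow> 'b \<Rightarrow> real) \<Rightarrow>
     'b \<Rightarrow> bool" where
  "assumption_A3 M \<pi> \<Theta> lik \<theta>\<^sub>0 \<longleftrightarrow>
     (\<forall>\<alpha>. tempering_sequence \<alpha> \<longrightarrow> (\<forall>\<epsilon>>0::real. \<forall>k\<^sub>0\<ge>0::real. \<exists>B::real. \<exists>N::nat.
        \<forall>n\<ge>1. \<alpha> n * real n \<ge> real N \<longrightarrow>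
          outer_prob (M n) (\<lambda>\<omega>.
            (\<integral>\<^sup>+ \<theta>. ennreal (norm (sqrt (\<alpha> n * real n) *\<^sub>R (\<theta> - \<theta>\<^sub>0)) powr k\<^sub>0
                       * posterior_density \<pi> \<Theta> (lik n \<omega>) (\<alpha> n) \<theta>) \<partial>lborel) > ennreal B)
          < ennreal \<epsilon>))"

definition assumption_A3' ::
    "(nat \<Rightarrow> 'w measure) \<Rightarrow> 'b::metric_space set \<Rightarrow> (nat \<Rightarrow> 'w \<Rightarrow> 'b \<Rightarrow> real) \<Rightarrow>
     (nat \<Rightarrow> 'w \<Rightarrow> 'b) \<Rightarrow> bool" where
  "assumption_A3' M \<Theta> lik mle \<longleftrightarrow>
     (\<forall>\<epsilon>>0::real. \<forall>\<delta>>0::real. \<exists>c>0::real. \<forall>\<^sub>F n in sequentially.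
        outer_prob (M n) (\<lambda>\<omega>.
          (SUP \<theta>\<in>\<Theta> - ball (mle n \<omega>) \<delta>.
             ereal (1 / real n) * elog (lik n \<omega> \<theta>)
             - ereal (1 / real n) * elog (lik n \<omega> (mle n \<omega>))) > ereal (- c))
        < ennreal \<epsilon>)"

definition condition_1 ::
    "(nat \<Rightarrow> 'w measure) \<Rightarrow> 'b::euclidean_space set \<Rightarrow> (nat \<Rightarrow> 'w \<Rightarrow> 'b \<Rightarrow> real) \<Rightarrow> 'b \<Rightarrow>
     real \<Rightarrow> real \<Rightarrow> real \<Rightarrow> real \<Rightarrow> real \<Rightarrow> (real \<Rightarrow> real) \<Rightarrow> bool" where
  "condition_1 M \<Theta> lik \<theta>\<^sub>0 L c\<^sub>0 c\<^sub>1 c\<^sub>2 r \<gamma> \<longleftrightarrow>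
     L > 0 \<and> c\<^sub>0 > 0 \<and> c\<^sub>1 > 0 \<and> c\<^sub>2 \<ge> 0 \<and> r > exp (c\<^sub>2 / c\<^sub>0) / c\<^sub>1 \<and>
     (\<forall>v\<ge>0. \<gamma> v \<ge> 0) \<and> (\<forall>v\<ge>r. \<gamma> v \<ge> c\<^sub>0 * ln (1 + c\<^sub>1 * v) - c\<^sub>2) \<and>
     with_prob_tending_to_one M (\<lambda>n \<omega>. \<forall>\<theta>\<in>\<Theta> - ball \<theta>\<^sub>0 r.
        elog (lik n \<omega> \<theta>) - elog (lik n \<omega> \<theta>\<^sub>0) \<le> ereal (- L * real n * \<gamma> (norm (\<theta> - \<theta>\<^sub>0))))"

definition condition_2 ::
    "(nat \<Rightarrow> 'w measure) \<Rightarrow> 'b::euclidean_space set \<Rightarrow> (nat \<Rightarrow> 'w \<Rightarrow> 'b \<Rightarrow> real) \<Rightarrow>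
     (nat \<Rightarrow> 'w \<Rightarrow> 'b) \<Rightarrow> real \<Rightarrow> bool" where
  "condition_2 M \<Theta> lik mle r \<longleftrightarrow>
     (\<exists>c\<^sub>3>0. \<exists>c\<^sub>4>0. with_prob_tending_to_one M (\<lambda>n \<omega>. \<forall>\<theta>\<in>\<Theta> \<inter> ball (mle n \<omega>) (2 * r).
        ereal (- real n * c\<^sub>3 * (norm (\<theta> - mle n \<omega>))\<^sup>2) \<le> elog (lik n \<omega> \<theta>) - elog (lik n \<omega> (mle n \<omega>)) \<and>
        elog (lik n \<omega> \<theta>) - elog (lik n \<omega> (mle n \<omega>)) \<le> ereal (- real n * c\<^sub>4 * (norm (\<theta> - mle n \<omega>))\<^sup>2)))"

end

theory Submission
  imports Defs
begin

text \<open>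
All measures in the statement collapse to the point mass at the estimator, and this alone
forces their Wasserstein distance to vanish.  If \<open>\<mu>\<close> and \<open>\<nu>\<close> both have small \<open>s\<close>-th moments about the same
point \<open>c\<close>, then their product is a coupling of small cost (\<open>wasserstein_le_centered_moments\<close>).  With \<open>c\<close>
the estimator, the moment of a mixture is the mixture of the moments, and the point mass contributes
nothing.  Three moments remain.

The normal component has covariance \<open>(\<alpha>\<^sub>n n)\<^sup>-\<^sup>1 V\<^sup>-\<^sup>1\<close>, so its \<open>s\<close>-th moment is of order
\<open>(\<alpha>\<^sub>n n) powr (- s / 2)\<close> and tends to zero because \<open>1 / n\<close> is negligible against \<open>\<alpha>\<^sub>n\<close>
(\<open>mv_normal_scaled_covariance\<close>).  That this component is a probability measure, without which no
coupling would exist, is the Gaussian integral for a general positive definite form; it is obtained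
by completing squares, that is, by factoring the form into shears and a diagonal scaling
(\<open>positive_definite_congruent_to_identity\<close>).

The two tempered posteriors are handled by one deterministic estimate
(\<open>tempered_posterior_concentrates_at_maximiser\<close>).  On an event of probability tending to one, the
log-likelihood lies between two downward parabolas of curvature proportional to \<open>n\<close> near the estimator, and at least
a multiple of \<open>n\<close> below its maximum elsewhere.  Tempering with exponent \<open>a\<close> replaces \<open>n\<close> by \<open>a n\<close>, so
outside a fixed ball the posterior density is at most a constant times \<open>exp (- a n e / 2)\<close> times the prior, for
some \<open>e > 0\<close>; the finite \<open>s\<close>-th prior moment turns this into a bound on the posterior moment.  The bound is
uniform over all exponents with \<open>a n\<close> large, hence applies both to exponents comparable to \<open>\<alpha>\<^sub>n\<close> and to
exponents tending to infinity, random or not.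
\<close>

section \<open>Convergence in outer probability\<close>

lemma outer_prob_null: "AE \<omega> in M. P \<omega> \<Longrightarrow> outer_prob M (\<lambda>\<omega>. \<not> P \<omega>) = 0"
proof -
  assume "AE \<omega> in M. P \<omega>"
  then obtain N where N: "{\<omega>\<in>space M. \<not> P \<omega>} \<subseteq> N" "emeasure M N = 0" "N \<in> sets M"
    by (rule AE_E)
  have "outer_prob M (\<lambda>\<omega>. \<not> P \<omega>) \<le> outer_measure_of M N"
    unfolding outer_prob_def using N(1) by (rule outer_measure_of_mono)
  then show ?thesis using N by simp
qed

lemma outer_prob_mono:
  assumes "\<And>\<omega>. \<omega> \<in> space M \<Longrightarrow> P \<omega> \<Longrightarrow> Q \<omega>"
  shows "outer_prob M P \<le> outer_prob M Q"
  unfolding outer_prob_def by (rule outer_measure_of_mono) (use assms in auto)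

text \<open>
Outer measure is subadditive because each event is contained in a measurable hull of the same
measure.  This keeps the usual calculus of \<open>with probability tending to one\<close> available for events
that involve uncountable suprema.
\<close>

lemma outer_prob_disj: "outer_prob M (\<lambda>\<omega>. P \<omega> \<or> Q \<omega>) \<le> outer_prob M P + outer_prob M Q"
proof -
  obtain A where A: "A \<in> sets M" "{\<omega>\<in>space M. P \<omega>} \<subseteq> A" "outer_prob M P = emeasure M A"
    using outer_measure_of_attain[of "{\<omega>\<in>space M. P \<omega>}" M] by (auto simp: outer_prob_def)
  obtain B where B: "B \<in> sets M" "{\<omega>\<in>space M. Q \<omega>} \<subseteq> B" "outer_prob M Q = emeasure M B"
    using outer_measure_of_attain[of "{\<omega>\<in>space M. Q \<omega>}" M] by (auto simp: outer_prob_def)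
  have "outer_prob M (\<lambda>\<omega>. P \<omega> \<or> Q \<omega>) \<le> outer_measure_of M (A \<union> B)"
    unfolding outer_prob_def by (rule outer_measure_of_mono) (use A B in auto)
  also have "\<dots> = emeasure M (A \<union> B)"
    using A B by simp
  also have "\<dots> \<le> emeasure M A + emeasure M B"
    using A B by (intro emeasure_subadditive) auto
  finally show ?thesis using A B by simp
qed

lemma with_prob_tending_to_one_mono:
  assumes "with_prob_tending_to_one M E"
    and "\<forall>\<^sub>F n in sequentially. \<forall>\<omega>\<in>space (M n). E n \<omega> \<longrightarrow> F n \<omega>"
  shows "with_prob_tending_to_one M F"
proof -
  have "\<forall>\<^sub>F n in sequentially. outer_prob (M n) (\<lambda>\<omega>. \<not> F n \<omega>) \<le> outer_prob (M n) (\<lambda>\<omega>. \<not> E n \<omega>)"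
    using assms(2) by eventually_elim (intro outer_prob_mono, blast)
  then show ?thesis
    using assms(1) unfolding with_prob_tending_to_one_def
    by (rule tendsto_sandwich[OF always_eventually[OF allI[OF zero_le]] _ tendsto_const])
qed

lemma with_prob_tending_to_one_conj:
  assumes "with_prob_tending_to_one M E" "with_prob_tending_to_one M F"
  shows "with_prob_tending_to_one M (\<lambda>n \<omega>. E n \<omega> \<and> F n \<omega>)"
proof -
  have "(\<lambda>n. outer_prob (M n) (\<lambda>\<omega>. \<not> E n \<omega>) + outer_prob (M n) (\<lambda>\<omega>. \<not> F n \<omega>)) \<longlonglongrightarrow> 0 + 0"
    using assms unfolding with_prob_tending_to_one_def by (intro tendsto_intros)
  then have "(\<lambda>n. outer_prob (M n) (\<lambda>\<omega>. \<not> E n \<omega>) + outer_prob (M n) (\<lambda>\<omega>. \<not> F n \<omega>)) \<longlonglongrightarrow> 0"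
    by simp
  then show ?thesis
    unfolding with_prob_tending_to_one_def de_Morgan_conj
    by (rule tendsto_sandwich[OF always_eventually[OF allI[OF zero_le]]
          always_eventually[OF allI[OF outer_prob_disj]] tendsto_const])
qed

lemma with_prob_tending_to_one_AE:
  assumes "\<And>n. n \<ge> 1 \<Longrightarrow> AE \<omega> in M n. E n \<omega>"
  shows "with_prob_tending_to_one M E"
  unfolding with_prob_tending_to_one_def
  using eventually_ge_at_top[of 1]
  by (intro tendsto_eventually, eventually_elim) (rule outer_prob_null[OF assms])

lemma tends_to_zero_in_prob_iff:
  "tends_to_zero_in_prob M Y \<longleftrightarrow>
     (\<forall>\<epsilon>>0::real. with_prob_tending_to_one M (\<lambda>n \<omega>. \<bar>Y n \<omega>\<bar> \<le> ereal \<epsilon>))"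
  by (simp add: tends_to_zero_in_prob_def with_prob_tending_to_one_def not_le)

section \<open>Mixtures and the Wasserstein distance\<close>

text \<open>
By monotone class: the identity holds for indicators by definition and both sides respect the
operations that generate all nonnegative measurable functions.
\<close>

lemma nn_integral_mixture:
  assumes sets: "sets \<nu> = sets \<mu>" and f: "f \<in> borel_measurable \<mu>"
  shows "(\<integral>\<^sup>+x. f x \<partial>mixture p \<mu> \<nu>)
    = ennreal p * (\<integral>\<^sup>+x. f x \<partial>\<mu>) + ennreal (1 - p) * (\<integral>\<^sup>+x. f x \<partial>\<nu>)"
proof -
  have space: "space \<nu> = space \<mu>" using sets by (rule sets_eq_imp_space_eq)
  have meas: "g \<in> borel_measurable \<nu>" "g \<in> borel_measurable (mixture p \<mu> \<nu>)"
    if "g \<in> borel_measurable \<mu>" for g :: "'a \<Rightarrow> ennreal"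
    using that by (simp_all add: measurable_def sets space)
  show ?thesis
    using f
  proof (induction rule: borel_measurable_induct)
    case (cong f g)
    have "integral\<^sup>N \<mu> f = integral\<^sup>N \<mu> g" "integral\<^sup>N \<nu> f = integral\<^sup>N \<nu> g"
      "integral\<^sup>N (mixture p \<mu> \<nu>) f = integral\<^sup>N (mixture p \<mu> \<nu>) g"
      by (rule nn_integral_cong, simp add: space cong(3))+
    with cong(4) show ?case
      by simp
  next
    case (set A)
    then show ?case
      using sets by (simp add: emeasure_mixture)
  next
    case (mult u c)
    show ?case
      unfolding nn_integral_cmult[OF mult(2)] nn_integral_cmult[OF meas(1)[OF mult(2)]]
        nn_integral_cmult[OF meas(2)[OF mult(2)]] mult.IH
      by (simp only: distrib_left mult.left_commute)
  next
    case (add u v)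
    note u = \<open>u \<in> borel_measurable \<mu>\<close> and v = \<open>v \<in> borel_measurable \<mu>\<close>
    show ?case
      unfolding nn_integral_add[OF v u] nn_integral_add[OF meas(1)[OF v] meas(1)[OF u]]
        nn_integral_add[OF meas(2)[OF v] meas(2)[OF u]] add.IH
      by (simp only: distrib_left ac_simps)
  next
    case (seq U)
    have inc: "incseq (\<lambda>i. c * integral\<^sup>N \<rho> (U i))" for c and \<rho> :: "'a measure"
      using seq(3) by (auto simp: mono_def le_fun_def intro!: mult_left_mono nn_integral_mono)
    have "integral\<^sup>N \<rho> (\<Squnion> range U) = (SUP i. integral\<^sup>N \<rho> (U i))"
      if "\<And>i. U i \<in> borel_measurable \<rho>" for \<rho> :: "'a measure"
      unfolding image_comp SUP_apply[abs_def] using nn_integral_monotone_convergence_SUP[OF seq(3) that]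
      by (simp add: image_comp)
    then show ?case
      by (simp only: seq(1) meas seq.IH SUP_mult_left_ennreal ennreal_SUP_add[OF inc inc])
  qed
qed

lemma prob_space_mixture:
  assumes "prob_space \<mu>" "prob_space \<nu>" "sets \<nu> = sets \<mu>" "0 \<le> p" "p \<le> 1"
  shows "prob_space (mixture p \<mu> \<nu>)"
proof (rule prob_spaceI)
  have "space \<nu> = space \<mu>" using assms(3) by (rule sets_eq_imp_space_eq)
  then have "emeasure \<mu> (space \<mu>) = 1" "emeasure \<nu> (space \<mu>) = 1"
    using assms(1,2) by (metis prob_space.emeasure_space_1)+
  then show "emeasure (mixture p \<mu> \<nu>) (space (mixture p \<mu> \<nu>)) = 1"
    using assms by (simp add: emeasure_mixture flip: ennreal_plus)
qed

text \<open>
A crude substitute for the triangle inequality in \<open>L\<^sup>s\<close>; the constant is irrelevant because only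
convergence to zero is at stake.
\<close>

lemma norm_add_powr_le:
  fixes x y :: "'a::real_normed_vector"
  assumes "s \<ge> 0"
  shows "norm (x + y) powr s \<le> 2 powr s * (norm x powr s + norm y powr s)"
proof -
  have "norm (x + y) powr s \<le> (2 * max (norm x) (norm y)) powr s"
    by (rule powr_mono2) (use assms norm_triangle_ineq[of x y] in auto)
  also have "\<dots> = 2 powr s * max (norm x) (norm y) powr s"
    by (simp add: powr_mult)
  also have "\<dots> \<le> 2 powr s * (norm x powr s + norm y powr s)"
    by (auto simp: max_def)
  finally show ?thesis .
qed

text \<open>
The product measure is a coupling, and its transport cost is controlled by sending all mass of both
measures to a common point \<open>c\<close>.  This loses nothing essential when both measures concentrate at \<open>c\<close>,
and it makes any finer coupling of the two mixtures unnecessary.  Both marginals must be probability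
measures, for otherwise there is no coupling at all and the distance is infinite.
\<close>

lemma wasserstein_le_centered_moments:
  fixes \<mu> \<nu> :: "'b::euclidean_space measure"
  assumes "prob_space \<mu>" "prob_space \<nu>"
    and sets[measurable_cong]: "sets \<mu> = sets borel" "sets \<nu> = sets borel"
    and s: "s > 0" and \<epsilon>: "\<epsilon> \<ge> 0"
    and bound: "ennreal (2 powr s) * ((\<integral>\<^sup>+x. ennreal (norm (x - c) powr s) \<partial>\<mu>)
              + (\<integral>\<^sup>+y. ennreal (norm (y - c) powr s) \<partial>\<nu>)) \<le> ennreal (\<epsilon> powr s)"
  shows "\<bar>wasserstein s \<mu> \<nu>\<bar> \<le> ereal \<epsilon>"
proof -
  interpret \<mu>: prob_space \<mu> by fact
  interpret \<nu>: prob_space \<nu> by fact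
  interpret pair_prob_space \<mu> \<nu> ..
  define I where "I = (INF \<gamma> \<in> couplings \<mu> \<nu>. \<integral>\<^sup>+ z. ennreal (norm (fst z - snd z) powr s) \<partial>\<gamma>)"
  have snd: "distr (\<mu> \<Otimes>\<^sub>M \<nu>) \<nu> snd = \<nu>"
  proof (rule measure_eqI)
    fix A assume "A \<in> sets (distr (\<mu> \<Otimes>\<^sub>M \<nu>) \<nu> snd)"
    then have A: "A \<in> sets \<nu>" by simp
    have "emeasure (distr (\<mu> \<Otimes>\<^sub>M \<nu>) \<nu> snd) A = emeasure (\<mu> \<Otimes>\<^sub>M \<nu>) (space \<mu> \<times> A)"
      using A sets.sets_into_space[OF A]
      by (auto simp: emeasure_distr space_pair_measure intro!: arg_cong2[where f=emeasure])
    then show "emeasure (distr (\<mu> \<Otimes>\<^sub>M \<nu>) \<nu> snd) A = emeasure \<nu> A"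
      using A by (simp add: \<nu>.emeasure_pair_measure_Times \<mu>.emeasure_space_1)
  qed simp
  have "\<mu> \<Otimes>\<^sub>M \<nu> \<in> couplings \<mu> \<nu>"
    unfolding couplings_def by (simp add: snd \<nu>.distr_pair_fst)
  then have "I \<le> (\<integral>\<^sup>+ z. ennreal (norm (fst z - snd z) powr s) \<partial>(\<mu> \<Otimes>\<^sub>M \<nu>))"
    unfolding I_def by (rule INF_lower)
  also have "\<dots> \<le> (\<integral>\<^sup>+ z. ennreal (2 powr s) * (ennreal (norm (fst z - c) powr s) + ennreal (norm (snd z - c) powr s)) \<partial>(\<mu> \<Otimes>\<^sub>M \<nu>))"
  proof (intro nn_integral_mono)
    fix z :: "'b \<times> 'b"
    have "norm (fst z - snd z) powr s \<le> 2 powr s * (norm (fst z - c) powr s + norm (snd z - c) powr s)"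
      using norm_add_powr_le[of s "fst z - c" "c - snd z"] s by (simp add: norm_minus_commute)
    then show "ennreal (norm (fst z - snd z) powr s)
       \<le> ennreal (2 powr s) * (ennreal (norm (fst z - c) powr s) + ennreal (norm (snd z - c) powr s))"
      by (simp flip: ennreal_plus ennreal_mult)
  qed
  also have "\<dots> = ennreal (2 powr s) * ((\<integral>\<^sup>+z. ennreal (norm (fst z - c) powr s) \<partial>(\<mu> \<Otimes>\<^sub>M \<nu>))
              + (\<integral>\<^sup>+z. ennreal (norm (snd z - c) powr s) \<partial>(\<mu> \<Otimes>\<^sub>M \<nu>)))"
    by (simp add: nn_integral_cmult nn_integral_add)
  also have "(\<integral>\<^sup>+z. ennreal (norm (fst z - c) powr s) \<partial>(\<mu> \<Otimes>\<^sub>M \<nu>)) = (\<integral>\<^sup>+x. ennreal (norm (x - c) powr s) \<partial>\<mu>)"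
    by (subst (2) \<nu>.distr_pair_fst[of \<mu>, symmetric]) (simp add: nn_integral_distr)
  also have "(\<integral>\<^sup>+z. ennreal (norm (snd z - c) powr s) \<partial>(\<mu> \<Otimes>\<^sub>M \<nu>)) = (\<integral>\<^sup>+x. ennreal (norm (x - c) powr s) \<partial>\<nu>)"
    by (subst (2) snd[symmetric]) (simp add: nn_integral_distr)
  also note bound
  finally have I: "I \<le> ennreal (\<epsilon> powr s)" .
  then have "I \<noteq> \<infinity>" by (metis ennreal_less_top infinity_ennreal_def leD)
  moreover have "enn2real I \<le> \<epsilon> powr s"
    using I by (intro enn2real_leI) auto
  then have "enn2real I powr (1 / s) \<le> (\<epsilon> powr s) powr (1 / s)"
    using s by (intro powr_mono2) auto
  moreover have "(\<epsilon> powr s) powr (1 / s) = \<epsilon>"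
    using s \<epsilon> by (simp add: powr_powr)
  ultimately show ?thesis
    unfolding wasserstein_def I_def[symmetric] by (simp add: Let_def)
qed

lemma ennreal_convex_combination_le:
  assumes "x \<le> ennreal D" "y \<le> ennreal D" "0 \<le> p" "p \<le> 1" "0 \<le> D"
  shows "ennreal p * x + ennreal (1 - p) * y \<le> ennreal D"
proof -
  have "ennreal p * x + ennreal (1 - p) * y \<le> ennreal p * ennreal D + ennreal (1 - p) * ennreal D"
    using assms by (intro add_mono mult_left_mono) auto
  also have "\<dots> = (ennreal p + ennreal (1 - p)) * ennreal D"
    by (rule distrib_right[symmetric])
  also have "ennreal p + ennreal (1 - p) = 1"
    using assms by (simp flip: ennreal_plus)
  finally show ?thesis by simp
qed

section \<open>Linear changes of variables for Lebesgue measure\<close>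

lemma nn_integral_lborel_translate:
  fixes f :: "'b::euclidean_space \<Rightarrow> ennreal"
  assumes [measurable]: "f \<in> borel_measurable borel"
  shows "(\<integral>\<^sup>+x. f (c + x) \<partial>lborel) = (\<integral>\<^sup>+x. f x \<partial>lborel)"
  by (subst (2) lborel_distr_plus[of c, symmetric]) (simp add: nn_integral_distr)

text \<open>
A shear along \<open>k\<close> moves each line in direction \<open>k\<close> by an amount that is constant on that line.  To
reduce this to translations of the whole space, average over a translation by \<open>u *\<^sub>R k\<close> with a weight
\<open>w u\<close> of total mass 1, exchange the integrals, and shift the weight instead of the argument.  The
argument needs no coordinates, so \<open>k\<close> may be any vector.
\<close>

lemma nn_integral_lborel_shear:
  fixes f :: "'b::euclidean_space \<Rightarrow> ennreal"
  assumes [measurable]: "f \<in> borel_measurable borel" "\<phi> \<in> borel_measurable borel"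
    and invariant: "\<And>x u. \<phi> (x + u *\<^sub>R k) = \<phi> x"
  shows "(\<integral>\<^sup>+x. f (x + \<phi> x *\<^sub>R k) \<partial>lborel) = (\<integral>\<^sup>+x. f x \<partial>lborel)"
proof -
  define w :: "real \<Rightarrow> ennreal" where "w = indicator {0..1}"
  have [measurable]: "w \<in> borel_measurable borel" by (simp add: w_def)
  have w: "(\<integral>\<^sup>+u. w (u + c) \<partial>lborel) = 1" for c
    using nn_integral_lborel_translate[of w c] by (simp add: w_def add.commute)
  have "(\<integral>\<^sup>+x. f (x + \<phi> x *\<^sub>R k) \<partial>lborel) = (\<integral>\<^sup>+u. w u * (\<integral>\<^sup>+x. f (x + \<phi> x *\<^sub>R k) \<partial>lborel) \<partial>lborel)"
    using w[of 0] by (simp add: nn_integral_multc)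
  also have "\<dots> = (\<integral>\<^sup>+u. \<integral>\<^sup>+x. w u * f (x + (u + \<phi> x) *\<^sub>R k) \<partial>lborel \<partial>lborel)"
  proof (rule nn_integral_cong)
    fix u
    have shift: "(u *\<^sub>R k + x) + \<phi> (u *\<^sub>R k + x) *\<^sub>R k = x + (u + \<phi> x) *\<^sub>R k" for x
      using invariant[of x u] by (simp add: algebra_simps)
    have "(\<integral>\<^sup>+x. f (x + \<phi> x *\<^sub>R k) \<partial>lborel) = (\<integral>\<^sup>+x. f (x + (u + \<phi> x) *\<^sub>R k) \<partial>lborel)"
      unfolding shift[symmetric]
      by (rule nn_integral_lborel_translate[symmetric]) simp
    then show "w u * (\<integral>\<^sup>+x. f (x + \<phi> x *\<^sub>R k) \<partial>lborel) = (\<integral>\<^sup>+x. w u * f (x + (u + \<phi> x) *\<^sub>R k) \<partial>lborel)"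
      by (simp add: nn_integral_cmult)
  qed
  also have "\<dots> = (\<integral>\<^sup>+x. \<integral>\<^sup>+u. w u * f (x + (u + \<phi> x) *\<^sub>R k) \<partial>lborel \<partial>lborel)"
    by (rule lborel_pair.Fubini') simp
  also have "\<dots> = (\<integral>\<^sup>+x. \<integral>\<^sup>+v. w (v - \<phi> x) * f (x + v *\<^sub>R k) \<partial>lborel \<partial>lborel)"
  proof (rule nn_integral_cong)
    fix x
    have "(\<integral>\<^sup>+u. w (\<phi> x + u - \<phi> x) * f (x + (\<phi> x + u) *\<^sub>R k) \<partial>lborel)
        = (\<integral>\<^sup>+v. w (v - \<phi> x) * f (x + v *\<^sub>R k) \<partial>lborel)"
      by (rule nn_integral_lborel_translate) simp
    then show "(\<integral>\<^sup>+u. w u * f (x + (u + \<phi> x) *\<^sub>R k) \<partial>lborel) = (\<integral>\<^sup>+v. w (v - \<phi> x) * f (x + v *\<^sub>R k) \<partial>lborel)"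
      by (simp add: add.commute[of "\<phi> x"])
  qed
  also have "\<dots> = (\<integral>\<^sup>+v. \<integral>\<^sup>+x. w (v - \<phi> x) * f (x + v *\<^sub>R k) \<partial>lborel \<partial>lborel)"
    by (rule lborel_pair.Fubini') simp
  also have "\<dots> = (\<integral>\<^sup>+v. \<integral>\<^sup>+y. w (v - \<phi> y) * f y \<partial>lborel \<partial>lborel)"
  proof (rule nn_integral_cong)
    fix v :: real
    have shift: "w (v - \<phi> x) * f (x + v *\<^sub>R k) = w (v - \<phi> (v *\<^sub>R k + x)) * f (v *\<^sub>R k + x)" for x
      using invariant[of x v] by (simp add: add.commute)
    show "(\<integral>\<^sup>+x. w (v - \<phi> x) * f (x + v *\<^sub>R k) \<partial>lborel) = (\<integral>\<^sup>+y. w (v - \<phi> y) * f y \<partial>lborel)"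
      unfolding shift by (rule nn_integral_lborel_translate) simp
  qed
  also have "\<dots> = (\<integral>\<^sup>+y. \<integral>\<^sup>+v. w (v - \<phi> y) * f y \<partial>lborel \<partial>lborel)"
    by (rule lborel_pair.Fubini') simp
  also have "\<dots> = (\<integral>\<^sup>+y. f y \<partial>lborel)"
    using w[of "- \<phi> y" for y] by (simp add: nn_integral_multc)
  finally show ?thesis .
qed

text \<open>
The linear change of variables formula for \<open>T\<close>.  It is treated as a property of \<open>T\<close>, closed
under products, because diagonal matrices and shears already suffice to normalise a quadratic form.
\<close>

definition scales_lebesgue_by_det :: "real^'p^'p \<Rightarrow> bool" where
  "scales_lebesgue_by_det T \<longleftrightarrow> det T \<noteq> 0 \<and>
     (\<forall>f\<in>borel_measurable borel. (\<integral>\<^sup>+x. f x \<partial>lborel) = ennreal \<bar>det T\<bar> * (\<integral>\<^sup>+x. f (T *v x) \<partial>lborel))"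

lemma borel_measurable_matrix_vector_mult [measurable]:
  fixes T :: "real^'p^'q"
  shows "(\<lambda>x. T *v x) \<in> borel_measurable borel"
  by (intro borel_measurable_continuous_onI linear_continuous_on) (simp add: linear_linear matrix_vector_mul_bounded_linear)

lemma scales_lebesgue_by_det_nonzero: "scales_lebesgue_by_det T \<Longrightarrow> det T \<noteq> 0"
  unfolding scales_lebesgue_by_det_def by (rule conjunct1)

lemma nn_integral_scales_lebesgue_by_det:
  assumes "scales_lebesgue_by_det T" "f \<in> borel_measurable borel"
  shows "(\<integral>\<^sup>+x. f x \<partial>lborel) = ennreal \<bar>det T\<bar> * (\<integral>\<^sup>+x. f (T *v x) \<partial>lborel)"
  using assms(1)[unfolded scales_lebesgue_by_det_def, THEN conjunct2] assms(2) by (rule bspec)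

lemma scales_lebesgue_by_det_mult:
  assumes S: "scales_lebesgue_by_det S" and T: "scales_lebesgue_by_det T"
  shows "scales_lebesgue_by_det (S ** T)"
  unfolding scales_lebesgue_by_det_def
proof (intro conjI ballI)
  show "det (S ** T) \<noteq> 0"
    using S T by (simp add: det_mul scales_lebesgue_by_det_nonzero)
  fix f :: "real^'a \<Rightarrow> ennreal" assume [measurable]: "f \<in> borel_measurable borel"
  have "(\<integral>\<^sup>+x. f x \<partial>lborel) = ennreal \<bar>det S\<bar> * (\<integral>\<^sup>+x. f (S *v x) \<partial>lborel)"
    using S by (rule nn_integral_scales_lebesgue_by_det) simp
  also have "(\<integral>\<^sup>+x. f (S *v x) \<partial>lborel) = ennreal \<bar>det T\<bar> * (\<integral>\<^sup>+x. f (S *v (T *v x)) \<partial>lborel)"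
    using T by (rule nn_integral_scales_lebesgue_by_det) simp
  finally show "(\<integral>\<^sup>+x. f x \<partial>lborel) = ennreal \<bar>det (S ** T)\<bar> * (\<integral>\<^sup>+x. f ((S ** T) *v x) \<partial>lborel)"
    by (simp add: det_mul abs_mult ennreal_mult mult.assoc matrix_vector_mul_assoc)
qed

lemma scales_lebesgue_by_det_diagonal:
  fixes d :: "'p::finite \<Rightarrow> real"
  assumes d: "\<And>i. d i \<noteq> 0"
  shows "scales_lebesgue_by_det (\<chi> i j. if i = j then d i else 0)" (is "scales_lebesgue_by_det ?D")
proof -
  have det: "det ?D = (\<Prod>i\<in>UNIV. d i)"
    by (subst det_diagonal) auto
  have Basis: "(Basis :: (real^'p) set) = range (\<lambda>i. axis i 1)"
    by (auto simp: Basis_vec_def)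
  have inj: "inj (\<lambda>i::'p. axis i (1::real))"
    by (auto simp: inj_on_def axis_eq_axis)
  define c where "c b = d (THE i. b = axis i (1::real))" for b
  have c: "c (axis i 1) = d i" for i
    by (simp add: c_def axis_eq_axis)
  have prod: "(\<Prod>b\<in>(Basis::(real^'p) set). \<bar>c b\<bar>) = \<bar>det ?D\<bar>"
    by (simp add: Basis prod.reindex[OF inj] c det abs_prod)
  have "(\<Sum>j\<in>Basis. (c j * (x \<bullet> j)) *\<^sub>R j) = (\<Sum>i\<in>UNIV. (d i * x $ i) *\<^sub>R axis i 1)" for x
    by (simp add: Basis sum.reindex[OF inj] c inner_axis)
  then have T: "0 + (\<Sum>j\<in>Basis. (c j * (x \<bullet> j)) *\<^sub>R j) = ?D *v x" for x
    by (simp add: vec_eq_iff matrix_vector_mult_def axis_def if_distrib if_distribR cong: if_cong)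
  have eq: "lborel = density (distr lborel borel (\<lambda>x. ?D *v x)) (\<lambda>_. ennreal \<bar>det ?D\<bar>)"
    unfolding T[symmetric] prod[symmetric]
    by (rule lborel_affine_euclidean) (auto simp: Basis c d)
  show ?thesis
    unfolding scales_lebesgue_by_det_def
  proof (intro conjI ballI)
    show "det ?D \<noteq> 0" using d by (simp add: det)
    fix f :: "real^'p \<Rightarrow> ennreal" assume [measurable]: "f \<in> borel_measurable borel"
    show "(\<integral>\<^sup>+x. f x \<partial>lborel) = ennreal \<bar>det ?D\<bar> * (\<integral>\<^sup>+x. f (?D *v x) \<partial>lborel)"
      by (subst eq) (simp add: nn_integral_density nn_integral_distr nn_integral_cmult)
  qed
qed

text \<open>
The matrix is \<open>I - e\<^sub>k w\<^sup>T\<close>.  As \<open>w\<close> has no component along \<open>e\<^sub>k\<close>, it arises from the identity by a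
row operation and so has determinant 1.
\<close>

lemma scales_lebesgue_by_det_shear:
  fixes w :: "real^'p"
  assumes w: "w $ k = 0"
  shows "scales_lebesgue_by_det (\<chi> i j. (if i = j then 1 else 0) - (if i = k then w $ j else 0))"
    (is "scales_lebesgue_by_det ?S")
proof -
  have unit: "(if i = j then 1 else 0) * y = (if i = j then y else 0)" for i j :: 'p and y :: real
    by simp
  have "(?S *v x) $ i = x $ i - (if i = k then w \<bullet> x else 0)" for x i
    by (cases "i = k")
       (simp_all add: matrix_vector_mult_def left_diff_distrib sum_subtractf unit inner_vec_def)
  then have Sx: "?S *v x = x + (- (w \<bullet> x)) *\<^sub>R axis k 1" for x
    by (simp add: vec_eq_iff axis_def)
  have "(\<Sum>j\<in>UNIV - {k}. (- (w $ j)) *s row j (mat 1 :: real^'p^'p)) $ i = - w $ i" for i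
  proof -
    have "(\<Sum>j\<in>UNIV - {k}. (- (w $ j)) *s row j (mat 1 :: real^'p^'p)) $ i
        = (\<Sum>j\<in>UNIV - {k}. if j = i then - w $ j else 0)"
      unfolding sum_component by (rule sum.cong) (auto simp: row_def mat_def)
    also have "\<dots> = - w $ i"
      using w by (auto simp: sum.delta)
    finally show ?thesis .
  qed
  then have "- w = (\<Sum>j\<in>UNIV - {k}. (- (w $ j)) *s row j (mat 1 :: real^'p^'p))"
    by (simp only: vec_eq_iff vector_uminus_component simp_thms)
  also have "\<dots> \<in> vec.span {row j (mat 1 :: real^'p^'p) |j. j \<noteq> k}"
    by (intro vec.span_sum vec.span_scale vec.span_base) auto
  finally have "det (\<chi> i. if i = k then row k (mat 1) + - w else row i (mat 1 :: real^'p^'p)) = det (mat 1 :: real^'p^'p)"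
    by (rule det_row_span)
  also have "(\<chi> i. if i = k then row k (mat 1) + - w else row i (mat 1 :: real^'p^'p)) = ?S"
    by (auto simp: vec_eq_iff row_def mat_def)
  finally have det: "det ?S = 1" by simp
  show ?thesis
    unfolding scales_lebesgue_by_det_def
  proof (intro conjI ballI)
    show "det ?S \<noteq> 0" by (simp add: det)
    fix f :: "real^'p \<Rightarrow> ennreal" assume f: "f \<in> borel_measurable borel"
    show "(\<integral>\<^sup>+x. f x \<partial>lborel) = ennreal \<bar>det ?S\<bar> * (\<integral>\<^sup>+x. f (?S *v x) \<partial>lborel)"
      unfolding Sx det using f
      by (subst nn_integral_lborel_shear) (auto simp: inner_add_right inner_axis w)
  qed
qed

lemma positive_definite_diagonal_pos:
  assumes "positive_definite V" shows "V $ k $ k > 0"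
proof -
  have "axis k 1 \<bullet> (V *v axis k 1) > 0"
    using assms unfolding positive_definite_def by (auto simp: axis_eq_0_iff)
  then show ?thesis
    by (simp add: matrix_vector_mul_component inner_axis inner_axis' )
qed

lemma symmetric_entry: "transpose V = V \<Longrightarrow> V $ i $ j = V $ j $ i"
  by (drule arg_cong[of _ _ "\<lambda>W. W $ j $ i"]) (simp add: transpose_def)

lemma inner_transpose_mult:
  fixes S :: "real^'p^'q"
  shows "x \<bullet> (transpose S *v y) = (S *v x) \<bullet> y"
  unfolding inner_commute[of x] inner_commute[of "S *v x"] transpose_matrix_vector by (rule dot_lmul_matrix)

lemma inner_congruence:
  fixes S V :: "real^'p^'p"
  shows "x \<bullet> ((transpose S ** V ** S) *v x) = (S *v x) \<bullet> (V *v (S *v x))"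
  unfolding matrix_vector_mul_assoc[symmetric] inner_transpose_mult ..

lemma positive_definite_congruence:
  assumes V: "positive_definite V" and S: "det S \<noteq> 0"
  shows "positive_definite (transpose S ** V ** S)"
  unfolding positive_definite_def
proof (intro conjI allI impI)
  show "transpose (transpose S ** V ** S) = transpose S ** V ** S"
    using V by (simp add: positive_definite_def matrix_transpose_mul matrix_mul_assoc)
  fix h :: "real^'a" assume "h \<noteq> 0"
  then have "S *v h \<noteq> 0"
    using injD[OF inj_matrix_vector_mult, of S h 0] S by (auto simp: invertible_det_nz)
  then show "h \<bullet> ((transpose S ** V ** S) *v h) > 0"
    using V by (simp add: inner_congruence positive_definite_def)
qed

lemma transpose_mult_entry:
  fixes A B :: "real^'p^'p"
  shows "(transpose A ** B) $ i $ j = (\<Sum>k\<in>UNIV. A $ k $ i * B $ k $ j)"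
  by (simp add: matrix_matrix_mult_def transpose_def)

text \<open>
Completion of squares, one coordinate at a time.  The induction is over a set \<open>K\<close> of indices outside
which \<open>V\<close> is already diagonal: the shear that eliminates the cross terms of the coordinate \<open>k\<close>
changes the remaining entries only inside \<open>K\<close>, and a diagonal form is normalised by rescaling.
Every factor used scales Lebesgue measure by its determinant, hence so does their product \<open>T\<close>.
\<close>

lemma positive_definite_congruent_to_identity:
  fixes V :: "real^'p^'p"
  assumes "positive_definite V"
  obtains T where "scales_lebesgue_by_det T" "transpose T ** V ** T = mat 1"
proof -
  have "\<exists>T. scales_lebesgue_by_det T \<and> transpose T ** V ** T = mat 1"
    if "finite K" "positive_definite V" "\<And>i j. i \<noteq> j \<Longrightarrow> V $ i $ j \<noteq> 0 \<Longrightarrow> i \<in> K \<and> j \<in> K"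
    for K and V :: "real^'p^'p"
    using that
  proof (induction K arbitrary: V rule: finite_induct)
    case empty
    define d where "d i = 1 / sqrt (V $ i $ i)" for i
    have pos: "V $ i $ i > 0" for i
      using empty by (intro positive_definite_diagonal_pos)
    then have d: "d i \<noteq> 0" "d i * (V $ i $ i * d i) = 1" for i
      by (auto simp: d_def field_simps less_le)
    have zero: "V $ i $ j = 0" if "i \<noteq> j" for i j
      using empty(2) that by blast
    let ?T = "(\<chi> i j. if i = j then d i else 0) :: real^'p^'p"
    have if_mult: "y * (if b then u else 0) = (if b then y * u else 0)"
        "(if b then u else 0) * y = (if b then u * y else 0)" for b and u y :: real
      by auto
    have VT: "(V ** ?T) $ i $ j = V $ i $ j * d j" for i j
      by (simp add: matrix_matrix_mult_def if_mult)
    have "(transpose ?T ** (V ** ?T)) $ i $ j = d i * (V $ i $ j * d j)" for i j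
      by (simp add: transpose_mult_entry if_mult VT)
    then have "transpose ?T ** V ** ?T = mat 1"
      using d zero by (auto simp: vec_eq_iff mat_def matrix_mul_assoc[symmetric])
    then show ?case
      using scales_lebesgue_by_det_diagonal[of d] d by blast
  next
    case (insert k K)
    \<comment> \<open>\<open>V\<^sub>k\<^sub>k (x\<^sub>k + w \<bullet> x)\<^sup>2\<close> collects all terms of the quadratic form that contain \<open>x\<^sub>k\<close>.\<close>
    define w :: "real^'p" where "w = (\<chi> j. if j = k then 0 else V $ k $ j / V $ k $ k)"
    define S :: "real^'p^'p" where "S = (\<chi> i j. (if i = j then 1 else 0) - (if i = k then w $ j else 0))"
    define V' where "V' = transpose S ** V ** S"
    have sym: "V $ i $ j = V $ j $ i" for i j
      using insert.prems(1) by (simp add: positive_definite_def symmetric_entry)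
    have pos: "V $ k $ k > 0"
      using insert.prems by (intro positive_definite_diagonal_pos)
    have S: "scales_lebesgue_by_det S"
      unfolding S_def by (rule scales_lebesgue_by_det_shear) (simp add: w_def)
    have if_mult: "y * (if b then u else 0) = (if b then y * u else 0)"
        "(if b then u else 0) * y = (if b then u * y else 0)" for b and u y :: real
      by auto
    have VS: "(V ** S) $ i $ j = V $ i $ j - V $ i $ k * w $ j" for i j
      by (simp add: S_def matrix_matrix_mult_def right_diff_distrib sum_subtractf if_mult)
    have "V' $ i $ j = (V ** S) $ i $ j - w $ i * (V ** S) $ k $ j" for i j
      unfolding V'_def matrix_mul_assoc[symmetric] transpose_mult_entry
      by (subst S_def) (simp add: left_diff_distrib sum_subtractf if_mult)
    then have V': "V' $ i $ j = V $ i $ j - V $ i $ k * w $ j - w $ i * (V $ k $ j - V $ k $ k * w $ j)" for i j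
      by (simp add: VS)
    have "\<exists>T. scales_lebesgue_by_det T \<and> transpose T ** V' ** T = mat 1"
    proof (rule insert.IH)
      show "positive_definite V'"
        unfolding V'_def using insert.prems S
        by (intro positive_definite_congruence) (auto dest: scales_lebesgue_by_det_nonzero)
      fix i j assume ij: "i \<noteq> j" "V' $ i $ j \<noteq> 0"
      have "V' $ k $ j = 0" if "j \<noteq> k" for j
        using that pos by (simp add: V' w_def)
      moreover have "V' $ i $ k = 0" if "i \<noteq> k" for i
        using that pos sym[of i k] by (simp add: V' w_def)
      ultimately have ne: "i \<noteq> k" "j \<noteq> k"
        using ij by metis+
      have "V $ i $ j \<noteq> 0 \<or> (V $ i $ k \<noteq> 0 \<and> V $ k $ j \<noteq> 0)"
        using ij(2) ne pos by (auto simp: V' w_def)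
      then show "i \<in> K \<and> j \<in> K"
        using insert.prems(2)[of i j] insert.prems(2)[of i k] insert.prems(2)[of k j] ne ij(1) by auto
    qed
    then obtain T where T: "scales_lebesgue_by_det T" "transpose T ** V' ** T = mat 1" by blast
    have "transpose (S ** T) ** V ** (S ** T) = mat 1"
      using T(2) by (simp add: V'_def matrix_transpose_mul matrix_mul_assoc)
    then show ?case
      using scales_lebesgue_by_det_mult[OF S T(1)] by blast
  qed
  from this[of UNIV V] assms show ?thesis using that by auto
qed

section \<open>Normal distributions\<close>

lemma matrix_inv_eqI:
  fixes A B :: "real^'p^'p"
  assumes "A ** B = mat 1"
  shows "matrix_inv A = B"
proof -
  have "B ** A = mat 1"
    using assms by (subst matrix_left_right_inverse)
  then have "A ** matrix_inv A = mat 1 \<and> matrix_inv A ** A = mat 1"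
    unfolding matrix_inv_def using assms
    by (intro someI[of "\<lambda>A'. A ** A' = mat 1 \<and> A' ** A = mat 1" B] conjI)
  then have "B ** (A ** matrix_inv A) = B"
    by simp
  then show ?thesis
    using \<open>B ** A = mat 1\<close> by (simp add: matrix_mul_assoc)
qed

text \<open>
The density factors over the coordinates.  The variance is kept free because a larger one is needed
to dominate the moments of the standard Gaussian.
\<close>

lemma nn_integral_gaussian_eq_1:
  assumes \<sigma>: "\<sigma> > 0"
  shows "(\<integral>\<^sup>+y. ennreal (exp (- (norm y)\<^sup>2 / (2 * \<sigma>\<^sup>2)) / sqrt (2 * pi * \<sigma>\<^sup>2) ^ DIM('b)) \<partial>(lborel :: ('b::euclidean_space) measure)) = 1"
proof -
  have "ennreal (exp (- (norm y)\<^sup>2 / (2 * \<sigma>\<^sup>2)) / sqrt (2 * pi * \<sigma>\<^sup>2) ^ DIM('b))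
      = (\<Prod>b\<in>Basis. ennreal (normal_density 0 \<sigma> (y \<bullet> b)))" for y :: 'b
  proof -
    have "(\<Prod>b\<in>(Basis::'b set). normal_density 0 \<sigma> (y \<bullet> b))
        = exp (\<Sum>b\<in>Basis. - ((y \<bullet> b)\<^sup>2) / (2 * \<sigma>\<^sup>2)) / sqrt (2 * pi * \<sigma>\<^sup>2) ^ DIM('b)"
      by (simp add: normal_density_def prod.distrib exp_sum prod_dividef)
    also have "(\<Sum>b\<in>Basis. - ((y \<bullet> b)\<^sup>2) / (2 * \<sigma>\<^sup>2)) = - (norm y)\<^sup>2 / (2 * \<sigma>\<^sup>2)"
      unfolding power2_norm_eq_inner
      by (subst euclidean_inner) (simp add: power2_eq_square sum_negf sum_divide_distrib)
    finally show ?thesis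
      by (subst prod_ennreal) auto
  qed
  then have "(\<integral>\<^sup>+y. ennreal (exp (- (norm y)\<^sup>2 / (2 * \<sigma>\<^sup>2)) / sqrt (2 * pi * \<sigma>\<^sup>2) ^ DIM('b)) \<partial>(lborel :: ('b) measure))
      = (\<integral>\<^sup>+y. (\<Prod>b\<in>Basis. ennreal (normal_density 0 \<sigma> (y \<bullet> b))) \<partial>(lborel :: ('b) measure))"
    by simp
  also have "\<dots> = (\<Prod>b\<in>(Basis::'b set). (\<integral>\<^sup>+u. ennreal (normal_density 0 \<sigma> u) \<partial>lborel))"
    by (rule nn_integral_lborel_prod) auto
  also have "(\<integral>\<^sup>+u. ennreal (normal_density 0 \<sigma> u) \<partial>lborel) = 1"
    using prob_space.emeasure_space_1[OF prob_space_normal_density[OF \<sigma>, of 0]]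
    by (simp add: emeasure_density)
  finally show ?thesis by simp
qed

definition std_gaussian :: "real^'p \<Rightarrow> real" where
  "std_gaussian y = exp (- (norm y)\<^sup>2 / 2) / sqrt (2 * pi) ^ CARD('p)"

lemma std_gaussian_nonneg [simp]: "0 \<le> std_gaussian y"
  by (simp add: std_gaussian_def)

lemma std_gaussian_measurable [measurable]: "std_gaussian \<in> borel_measurable borel"
  unfolding std_gaussian_def[abs_def] by measurable

lemma nn_integral_std_gaussian: "(\<integral>\<^sup>+y. ennreal (std_gaussian y) \<partial>lborel) = 1"
  using nn_integral_gaussian_eq_1[of 1, where 'b="real^'p"] by (simp add: std_gaussian_def)

text \<open>
From \<open>x \<le> exp x\<close> and \<open>s x \<le> s\<^sup>2 + x\<^sup>2 / 4\<close> one gets \<open>x powr s \<le> exp (s\<^sup>2 + x\<^sup>2 / 4)\<close>, so the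
integrand is bounded by a multiple of the Gaussian density of variance 2.
\<close>

lemma std_gaussian_moment_finite:
  assumes "s \<ge> 0"
  shows "(\<integral>\<^sup>+y. ennreal (norm y powr s * std_gaussian y) \<partial>(lborel :: (real^'p) measure)) < \<infinity>"
proof -
  let ?g = "\<lambda>y::real^'p. exp (- (norm y)\<^sup>2 / (2 * (sqrt 2)\<^sup>2)) / sqrt (2 * pi * (sqrt 2)\<^sup>2) ^ CARD('p)"
  let ?K = "exp (s\<^sup>2) * sqrt 2 ^ CARD('p)"
  have "2 * pi * (sqrt 2)\<^sup>2 = 2 * (2 * pi)" by simp
  then have const: "sqrt (2 * pi * (sqrt 2)\<^sup>2) = sqrt 2 * sqrt (2 * pi)"
    by (simp only: real_sqrt_mult)
  have bound: "norm y powr s * std_gaussian y \<le> ?K * ?g y" for y :: "real^'p"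
  proof -
    have "norm y powr s \<le> exp (norm y) powr s"
      using assms by (intro powr_mono2) (auto intro: order_trans[OF _ exp_ge_add_one_self])
    also have "\<dots> = exp (s * norm y)"
      by (simp add: powr_def)
    also have "s * norm y \<le> s\<^sup>2 + (norm y)\<^sup>2 / 4"
      using zero_le_power2[of "norm y / 2 - s"] by (simp add: power2_eq_square algebra_simps)
    finally have "norm y powr s * exp (- (norm y)\<^sup>2 / 2) \<le> exp (s\<^sup>2 + (norm y)\<^sup>2 / 4) * exp (- (norm y)\<^sup>2 / 2)"
      by (intro mult_right_mono) auto
    also have "\<dots> = exp (s\<^sup>2) * exp (- (norm y)\<^sup>2 / 4)"
      by (simp flip: exp_add)
    finally have "norm y powr s * std_gaussian y \<le> exp (s\<^sup>2) * exp (- (norm y)\<^sup>2 / 4) / sqrt (2 * pi) ^ CARD('p)"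
      unfolding std_gaussian_def times_divide_eq_right by (intro divide_right_mono) auto
    also have "\<dots> = ?K * ?g y"
      unfolding const power_mult_distrib by (simp del: real_sqrt_mult)
    finally show ?thesis .
  qed
  have "(\<integral>\<^sup>+y. ennreal (norm y powr s * std_gaussian y) \<partial>(lborel :: (real^'p) measure))
      \<le> (\<integral>\<^sup>+y. ennreal ?K * ennreal (?g y) \<partial>(lborel :: (real^'p) measure))"
    by (rule nn_integral_mono) (use bound in \<open>simp flip: ennreal_mult add: ennreal_leI\<close>)
  also have "\<dots> = ennreal ?K"
    using nn_integral_gaussian_eq_1[of "sqrt 2", where 'b="real^'p"] by (simp add: nn_integral_cmult)
  finally show ?thesis
    by (rule order_le_less_trans) (simp add: ennreal_less_top)
qed

text \<open>
The normal distribution with covariance \<open>S S\<^sup>T\<close> is the image of the standard one under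
\<open>y \<mapsto> \<mu> + S y\<close>: the substitution turns the quadratic form of the exponent into \<open>y \<bullet> y\<close>, and the factor
\<open>\<bar>det S\<bar>\<close> cancels the determinant in the normalisation.
\<close>

lemma nn_integral_mv_normal:
  fixes S :: "real^'p^'p"
  assumes S: "scales_lebesgue_by_det S" and [measurable]: "g \<in> borel_measurable borel"
  shows "(\<integral>\<^sup>+x. g x \<partial>mv_normal \<mu> (S ** transpose S)) = (\<integral>\<^sup>+y. ennreal (std_gaussian y) * g (\<mu> + S *v y) \<partial>lborel)"
proof -
  let ?\<Sigma> = "S ** transpose S"
  have det: "det S \<noteq> 0" using S by (rule scales_lebesgue_by_det_nonzero)
  then have "invertible S" by (simp add: invertible_det_nz)
  then obtain R where R: "S ** R = mat 1" "R ** S = mat 1"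
    unfolding invertible_def by (elim exE conjE)
  have "?\<Sigma> ** (transpose R ** R) = S ** transpose (R ** S) ** R"
    by (simp only: matrix_transpose_mul matrix_mul_assoc)
  also have "\<dots> = mat 1" using R by simp
  finally have inv: "matrix_inv ?\<Sigma> = transpose R ** R"
    by (rule matrix_inv_eqI)
  have dens: "\<bar>det S\<bar> * mv_normal_density \<mu> ?\<Sigma> (\<mu> + S *v y) = std_gaussian y" for y
  proof -
    have "(S *v y) \<bullet> ((transpose R ** R) *v (S *v y)) = (R *v (S *v y)) \<bullet> (R *v (S *v y))"
      by (simp only: matrix_vector_mul_assoc[symmetric] inner_transpose_mult)
    also have "R *v (S *v y) = y"
      using R by (simp add: matrix_vector_mul_assoc)
    finally have "mv_normal_density \<mu> ?\<Sigma> (\<mu> + S *v y) = exp (- (norm y)\<^sup>2 / 2) / sqrt ((2 * pi) ^ CARD('p) * (det S)\<^sup>2)"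
      by (simp add: mv_normal_density_def inv det_mul power2_norm_eq_inner power2_eq_square[of "det S"])
    also have "sqrt ((2 * pi) ^ CARD('p) * (det S)\<^sup>2) = sqrt (2 * pi) ^ CARD('p) * \<bar>det S\<bar>"
      by (simp only: real_sqrt_mult[of "(2 * pi) ^ CARD('p)"] real_sqrt_power[of "2 * pi"] real_sqrt_abs)
    finally show ?thesis
      using det by (simp add: std_gaussian_def del: real_sqrt_mult)
  qed
  have [measurable]: "mv_normal_density \<mu> ?\<Sigma> \<in> borel_measurable borel"
    unfolding mv_normal_density_def[abs_def] by measurable
  have "(\<integral>\<^sup>+x. g x \<partial>mv_normal \<mu> ?\<Sigma>) = (\<integral>\<^sup>+x. ennreal (mv_normal_density \<mu> ?\<Sigma> x) * g x \<partial>lborel)"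
    unfolding mv_normal_def by (rule nn_integral_density) measurable
  also have "\<dots> = (\<integral>\<^sup>+z. ennreal (mv_normal_density \<mu> ?\<Sigma> (\<mu> + z)) * g (\<mu> + z) \<partial>lborel)"
    by (rule nn_integral_lborel_translate[symmetric]) measurable
  also have "\<dots> = ennreal \<bar>det S\<bar> * (\<integral>\<^sup>+y. ennreal (mv_normal_density \<mu> ?\<Sigma> (\<mu> + S *v y)) * g (\<mu> + S *v y) \<partial>lborel)"
    using S by (rule nn_integral_scales_lebesgue_by_det) measurable
  also have "\<dots> = (\<integral>\<^sup>+y. ennreal \<bar>det S\<bar> * (ennreal (mv_normal_density \<mu> ?\<Sigma> (\<mu> + S *v y)) * g (\<mu> + S *v y)) \<partial>lborel)"
    by (rule nn_integral_cmult[symmetric]) measurable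
  also have "\<dots> = (\<integral>\<^sup>+y. ennreal (std_gaussian y) * g (\<mu> + S *v y) \<partial>lborel)"
    by (rule nn_integral_cong) (simp add: dens[symmetric] ennreal_mult' mult.assoc)
  finally show ?thesis .
qed

text \<open>
With \<open>T\<^sup>T V T = I\<close> the covariance \<open>c V\<^sup>-\<^sup>1\<close> equals \<open>(sqrt c T) (sqrt c T)\<^sup>T\<close>, so the distribution is the
image of the standard Gaussian under \<open>y \<mapsto> \<mu> + sqrt c T y\<close>.  This gives total mass 1, and moments about
the mean of order \<open>sqrt c powr s\<close> uniformly in the mean.
\<close>

lemma mv_normal_scaled_covariance:
  fixes V :: "real^'p^'p"
  assumes V: "positive_definite V" and s: "s \<ge> 0"
  obtains K where
    "\<And>\<mu> c. c > 0 \<Longrightarrow> prob_space (mv_normal \<mu> (c *\<^sub>R matrix_inv V))"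
    "\<And>\<mu> c. c > 0 \<Longrightarrow> (\<integral>\<^sup>+x. ennreal (norm (x - \<mu>) powr s) \<partial>mv_normal \<mu> (c *\<^sub>R matrix_inv V)) \<le> ennreal (K * sqrt c powr s)"
proof -
  obtain T where T: "scales_lebesgue_by_det T" and TVT: "transpose T ** V ** T = mat 1"
    using V by (rule positive_definite_congruent_to_identity)
  have "T ** (transpose T ** V) = mat 1"
    by (subst matrix_left_right_inverse) (rule TVT)
  then have "V ** (T ** transpose T) = mat 1"
    by (subst matrix_left_right_inverse) (simp only: matrix_mul_assoc)
  then have inv: "matrix_inv V = T ** transpose T"
    by (rule matrix_inv_eqI)
  \<comment> \<open>\<open>sqrt c\<close> times the identity, as a diagonal matrix so that it composes with \<open>T\<close>\<close>
  define D where "D c = (\<chi> i j. if i = j then sqrt c else 0 :: real^'p^'p)" for c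
  have D: "D c *v y = sqrt c *\<^sub>R y" for c y
  proof -
    have unit: "(if i = j then u else 0) * z = (if i = j then u * z else 0)" for i j :: 'p and u z :: real
      by simp
    show ?thesis
      by (simp add: D_def vec_eq_iff matrix_vector_mult_def unit)
  qed
  have DT: "transpose (D c) = D c" for c
    by (auto simp: D_def transpose_def vec_eq_iff)
  have cov: "c *\<^sub>R matrix_inv V = (T ** D c) ** transpose (T ** D c)" if "c > 0" for c
    unfolding inv matrix_transpose_mul DT matrix_eq using that
    by (simp add: matrix_vector_mul_assoc[symmetric] D matrix_vector_mult_scaleR scaleR_matrix_vector_assoc[symmetric])
  have TD: "scales_lebesgue_by_det (T ** D c)" if "c > 0" for c
    unfolding D_def using that by (intro scales_lebesgue_by_det_mult[OF T] scales_lebesgue_by_det_diagonal) auto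
  define m where "m = (\<integral>\<^sup>+y. ennreal (norm y powr s * std_gaussian y) \<partial>(lborel :: (real^'p) measure))"
  have m: "m = ennreal (enn2real m)"
    using std_gaussian_moment_finite[OF s, where 'p='p] by (simp add: m_def)
  define B where "B = onorm ((*v) T)"
  have B: "norm (T *v y) \<le> B * norm y" for y
    unfolding B_def by (rule onorm) simp
  have B0: "B \<ge> 0" unfolding B_def by (rule onorm_pos_le) simp
  show ?thesis
  proof (rule that[of "B powr s * enn2real m"])
    fix \<mu> :: "real^'p" and c :: real assume c: "c > 0"
    show "prob_space (mv_normal \<mu> (c *\<^sub>R matrix_inv V))"
    proof (rule prob_spaceI)
      have "emeasure (mv_normal \<mu> (c *\<^sub>R matrix_inv V)) (space (mv_normal \<mu> (c *\<^sub>R matrix_inv V)))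
          = (\<integral>\<^sup>+x. 1 \<partial>mv_normal \<mu> (c *\<^sub>R matrix_inv V))"
        by simp
      also have "\<dots> = 1"
        unfolding cov[OF c] by (subst nn_integral_mv_normal[OF TD[OF c]]) (simp_all add: nn_integral_std_gaussian)
      finally show "emeasure (mv_normal \<mu> (c *\<^sub>R matrix_inv V)) (space (mv_normal \<mu> (c *\<^sub>R matrix_inv V))) = 1" .
    qed
    have "(\<integral>\<^sup>+x. ennreal (norm (x - \<mu>) powr s) \<partial>mv_normal \<mu> (c *\<^sub>R matrix_inv V))
        = (\<integral>\<^sup>+y. ennreal (std_gaussian y) * ennreal (norm (\<mu> + (T ** D c) *v y - \<mu>) powr s) \<partial>lborel)"
      unfolding cov[OF c] using TD[OF c] by (rule nn_integral_mv_normal) measurable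
    also have "\<dots> \<le> (\<integral>\<^sup>+y. ennreal (B powr s * sqrt c powr s) * ennreal (norm y powr s * std_gaussian (y :: real^'p)) \<partial>lborel)"
    proof (rule nn_integral_mono)
      fix y :: "real^'p"
      have "norm (\<mu> + (T ** D c) *v y - \<mu>) = sqrt c * norm (T *v y)"
        using c by (simp add: matrix_vector_mul_assoc[symmetric] D matrix_vector_mult_scaleR)
      also have "\<dots> \<le> B * sqrt c * norm y"
        using mult_left_mono[OF B[of y], of "sqrt c"] c by (simp add: ac_simps)
      finally have "norm (\<mu> + (T ** D c) *v y - \<mu>) powr s \<le> (B * sqrt c * norm y) powr s"
        using s by (intro powr_mono2) auto
      also have "\<dots> = B powr s * sqrt c powr s * norm y powr s"
        using B0 c by (simp add: powr_mult)
      finally have "norm (\<mu> + (T ** D c) *v y - \<mu>) powr s * std_gaussian y \<le> B powr s * sqrt c powr s * norm y powr s * std_gaussian y"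
        by (rule mult_right_mono) (simp add: std_gaussian_def)
      then show "ennreal (std_gaussian y) * ennreal (norm (\<mu> + (T ** D c) *v y - \<mu>) powr s)
          \<le> ennreal (B powr s * sqrt c powr s) * ennreal (norm y powr s * std_gaussian y)"
        by (simp add: mult_ac ennreal_leI flip: ennreal_mult)
    qed
    also have "\<dots> = ennreal (B powr s * sqrt c powr s) * m"
      unfolding m_def by (rule nn_integral_cmult) measurable
    also have "\<dots> = ennreal (B powr s * enn2real m * sqrt c powr s)"
      by (subst m) (simp add: ac_simps flip: ennreal_mult)
    finally show "(\<integral>\<^sup>+x. ennreal (norm (x - \<mu>) powr s) \<partial>mv_normal \<mu> (c *\<^sub>R matrix_inv V)) \<le> ennreal (B powr s * enn2real m * sqrt c powr s)" .
  qed
qed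

section \<open>Concentration of tempered posteriors\<close>

text \<open>
The majorant \<open>z\<close> will be the maximal likelihood, while \<open>y\<close> is the likelihood at the point of
comparison, which may vanish.  In that case the extended difference is \<open>\<infinity>\<close> unless \<open>x\<close> vanishes too,
and then there is nothing to prove.
\<close>

lemma elog_diff_le_imp_powr_le:
  assumes le: "elog x - elog y \<le> ereal b" and "0 \<le> x" "x \<le> z" "y \<le> z" "0 \<le> a"
  shows "x powr a \<le> z powr a * exp (a * b)"
proof (cases "x = 0")
  case False
  then have x: "x > 0" using \<open>0 \<le> x\<close> by simp
  then have z: "z > 0" using \<open>x \<le> z\<close> by simp
  have y: "y > 0"
  proof (rule ccontr)
    assume "\<not> y > 0"
    then show False using le x by (simp add: elog_def)
  qed
  have "ln x \<le> ln y + b"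
    using le x y by (simp add: elog_def)
  also have "ln y \<le> ln z" using y \<open>y \<le> z\<close> by simp
  finally have "a * ln x \<le> a * ln z + a * b"
    using \<open>0 \<le> a\<close> by (metis add_le_cancel_right distrib_left mult_left_mono)
  then show ?thesis
    using x z by (simp add: powr_def flip: exp_add)
qed simp

lemma elog_diff_ge_imp_powr_ge:
  assumes ge: "ereal b \<le> elog x - elog y" and "0 < y" "0 \<le> a"
  shows "y powr a * exp (a * b) \<le> x powr a"
proof -
  have x: "x > 0"
  proof (rule ccontr)
    assume "\<not> x > 0"
    then show False using ge \<open>0 < y\<close> by (simp add: elog_def)
  qed
  have "ln y + b \<le> ln x"
    using ge x \<open>0 < y\<close> by (simp add: elog_def)
  then have "a * ln y + a * b \<le> a * ln x"
    using \<open>0 \<le> a\<close> by (metis distrib_left mult_left_mono)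
  then show ?thesis
    using x \<open>0 < y\<close> by (simp add: powr_def flip: exp_add)
qed

lemma prob_space_posterior:
  fixes \<pi> :: "'b::euclidean_space \<Rightarrow> real"
  assumes proper: "proper_posterior \<pi> \<Theta> l a" and nonneg: "\<And>\<theta>. \<theta> \<in> \<Theta> \<Longrightarrow> 0 \<le> \<pi> \<theta>"
  shows "prob_space (posterior \<pi> \<Theta> l a)"
proof (rule prob_spaceI)
  let ?Z = "\<integral>\<theta>. tempered \<pi> \<Theta> l a \<theta> \<partial>lborel"
  have int: "integrable lborel (tempered \<pi> \<Theta> l a)" and Z: "?Z > 0"
    using proper by (auto simp: proper_posterior_def)
  have pos: "0 \<le> tempered \<pi> \<Theta> l a \<theta>" for \<theta>
    using nonneg by (auto simp: tempered_def indicator_def)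
  have [measurable]: "posterior_density \<pi> \<Theta> l a \<in> borel_measurable borel"
    using borel_measurable_integrable[OF int] unfolding posterior_density_def[abs_def] by simp
  have "emeasure (posterior \<pi> \<Theta> l a) (space (posterior \<pi> \<Theta> l a))
      = (\<integral>\<^sup>+\<theta>. ennreal (posterior_density \<pi> \<Theta> l a \<theta>) \<partial>lborel)"
    by (simp add: posterior_def emeasure_density)
  also have "\<dots> = ennreal (\<integral>\<theta>. posterior_density \<pi> \<Theta> l a \<theta> \<partial>lborel)"
    using int pos Z unfolding posterior_density_def[abs_def]
    by (intro nn_integral_eq_integral) auto
  also have "(\<integral>\<theta>. posterior_density \<pi> \<Theta> l a \<theta> \<partial>lborel) = 1"
    using Z by (simp add: posterior_density_def[abs_def])
  finally show "emeasure (posterior \<pi> \<Theta> l a) (space (posterior \<pi> \<Theta> l a)) = 1"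
    by simp
qed

text \<open>
Laplace's method in its crudest form.  Up to the factor \<open>A\<close> (the tempered maximal likelihood), the
tempered likelihood is at most \<open>E\<close> at distance \<open>\<delta>\<close> or more from \<open>c\<close> and at least \<open>F\<close> on a ball around \<open>c\<close>.  The
ball bounds the normalising constant from below, so outside the \<open>\<delta>\<close>-ball the posterior density is at
most a constant times \<open>E / F\<close> times the prior; inside the \<open>\<delta>\<close>-ball the integrand is at most \<open>\<delta> powr s\<close>.
\<close>

lemma posterior_moment_le:
  fixes \<pi> :: "'b::euclidean_space \<Rightarrow> real"
  assumes proper: "proper_posterior \<pi> \<Theta> l a"
    and \<pi>: "(\<lambda>\<theta>. indicator \<Theta> \<theta> * \<pi> \<theta>) \<in> borel_measurable borel" "\<And>\<theta>. \<theta> \<in> \<Theta> \<Longrightarrow> 0 \<le> \<pi> \<theta>"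
    and pos: "\<delta> > 0" "t > 0" "p > 0" "s > 0" "A > 0" "K \<ge> 0"
    and upper: "\<And>\<theta>. \<theta> \<in> \<Theta> \<Longrightarrow> \<delta> \<le> norm (\<theta> - c) \<Longrightarrow> l \<theta> powr a \<le> A * E"
    and lower: "\<And>\<theta>. \<theta> \<in> ball c t \<Longrightarrow> \<theta> \<in> \<Theta> \<and> p \<le> \<pi> \<theta> \<and> A * F \<le> l \<theta> powr a"
    and EF: "0 \<le> E" "0 < F"
    and moment: "(\<integral>\<^sup>+\<theta>\<in>\<Theta>. ennreal (norm (\<theta> - c) powr s * \<pi> \<theta>) \<partial>lborel) \<le> ennreal K"
  shows "(\<integral>\<^sup>+\<theta>. ennreal (norm (\<theta> - c) powr s) \<partial>posterior \<pi> \<Theta> l a)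
      \<le> ennreal (\<delta> powr s + K / (p * measure lborel (ball c t)) * (E / F))"
proof -
  let ?Z = "\<integral>\<theta>. tempered \<pi> \<Theta> l a \<theta> \<partial>lborel"
  let ?v = "measure lborel (ball c t)"
  let ?d = "posterior_density \<pi> \<Theta> l a"
  interpret P: prob_space "posterior \<pi> \<Theta> l a"
    using proper \<pi>(2) by (rule prob_space_posterior)
  have int: "integrable lborel (tempered \<pi> \<Theta> l a)" and Z: "?Z > 0"
    using proper by (auto simp: proper_posterior_def)
  have temp0: "0 \<le> tempered \<pi> \<Theta> l a \<theta>" for \<theta>
    using \<pi>(2) by (auto simp: tempered_def indicator_def)
  have d0: "0 \<le> ?d \<theta>" for \<theta>
    using temp0 Z by (simp add: posterior_density_def)
  have [measurable]: "?d \<in> borel_measurable borel"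
    using borel_measurable_integrable[OF int] unfolding posterior_density_def[abs_def] by simp
  have v: "?v > 0"
    using pos by (simp add: content_ball_pos)
  have ballfin: "emeasure lborel (ball c t) < \<infinity>"
    by (rule emeasure_bounded_finite) simp
  have "A * F * p * ?v = (\<integral>\<theta>. indicator (ball c t) \<theta> * (A * F * p) \<partial>lborel)"
    by simp
  also have "\<dots> \<le> ?Z"
  proof (rule integral_mono)
    show "integrable lborel (\<lambda>\<theta>. indicator (ball c t) \<theta> * (A * F * p))"
      using ballfin by (intro integrable_mult_left integrable_real_indicator) auto
    show "integrable lborel (tempered \<pi> \<Theta> l a)" by fact
    fix \<theta> :: 'b
    show "indicator (ball c t) \<theta> * (A * F * p) \<le> tempered \<pi> \<Theta> l a \<theta>"
    proof (cases "\<theta> \<in> ball c t")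
      case True
      from lower[OF True] have "A * F * p \<le> l \<theta> powr a * \<pi> \<theta>" "\<theta> \<in> \<Theta>"
        using pos EF by (auto intro!: mult_mono)
      with True show ?thesis by (simp add: tempered_def)
    qed (simp add: temp0)
  qed
  finally have Zge: "A * F * p * ?v \<le> ?Z" .
  define C where "C = A * E / ?Z"
  have C: "C \<ge> 0" using pos EF Z by (simp add: C_def)
  have "C \<le> A * E / (A * F * p * ?v)"
    unfolding C_def using pos EF v Zge Z by (intro divide_left_mono) auto
  also have "\<dots> = E / F / (p * ?v)"
    using pos EF by simp
  finally have Cle: "C \<le> E / F / (p * ?v)" .
  have split: "?d \<theta> * norm (\<theta> - c) powr s
      \<le> \<delta> powr s * ?d \<theta> + C * (norm (\<theta> - c) powr s * (indicator \<Theta> \<theta> * \<pi> \<theta>))" for \<theta>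
  proof (cases "\<theta> \<in> \<Theta> \<and> \<delta> \<le> norm (\<theta> - c)")
    case True
    then have "?d \<theta> \<le> C * \<pi> \<theta>"
      using upper[of \<theta>] \<pi>(2)[of \<theta>] Z
      by (simp add: C_def posterior_density_def tempered_def divide_right_mono mult_right_mono)
    then have "?d \<theta> * norm (\<theta> - c) powr s \<le> C * \<pi> \<theta> * norm (\<theta> - c) powr s"
      by (rule mult_right_mono) simp
    moreover have "0 \<le> \<delta> powr s * ?d \<theta>" using d0 by simp
    moreover have "C * (norm (\<theta> - c) powr s * (indicator \<Theta> \<theta> * \<pi> \<theta>)) = C * \<pi> \<theta> * norm (\<theta> - c) powr s"
      using True by (simp add: mult.assoc mult.commute)
    ultimately show ?thesis by linarith
  next
    case False
    then have "?d \<theta> = 0 \<or> norm (\<theta> - c) powr s \<le> \<delta> powr s"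
      using pos by (auto intro!: powr_mono2 simp: posterior_density_def tempered_def)
    then have "?d \<theta> * norm (\<theta> - c) powr s \<le> ?d \<theta> * \<delta> powr s"
      using d0[of \<theta>] by (auto intro: mult_left_mono)
    moreover have "0 \<le> C * (norm (\<theta> - c) powr s * (indicator \<Theta> \<theta> * \<pi> \<theta>))"
      using \<pi>(2) by (intro mult_nonneg_nonneg[OF C]) (auto simp: indicator_def)
    ultimately show ?thesis by (simp add: mult.commute)
  qed
  have [measurable]: "(\<lambda>\<theta>. ennreal (norm (\<theta> - c) powr s * (indicator \<Theta> \<theta> * \<pi> \<theta>))) \<in> borel_measurable borel"
    using \<pi>(1) by measurable
  have "(\<integral>\<^sup>+\<theta>. ennreal (norm (\<theta> - c) powr s) \<partial>posterior \<pi> \<Theta> l a)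
      = (\<integral>\<^sup>+\<theta>. ennreal (?d \<theta>) * ennreal (norm (\<theta> - c) powr s) \<partial>lborel)"
    unfolding posterior_def by (rule nn_integral_density) measurable
  also have "\<dots> \<le> (\<integral>\<^sup>+\<theta>. ennreal (\<delta> powr s) * ennreal (?d \<theta>)
       + ennreal C * ennreal (norm (\<theta> - c) powr s * (indicator \<Theta> \<theta> * \<pi> \<theta>)) \<partial>lborel)"
  proof (rule nn_integral_mono)
    fix \<theta> :: 'b
    have "0 \<le> norm (\<theta> - c) powr s * (indicator \<Theta> \<theta> * \<pi> \<theta>)"
      using \<pi>(2) by (auto simp: indicator_def)
    then show "ennreal (?d \<theta>) * ennreal (norm (\<theta> - c) powr s) \<le> ennreal (\<delta> powr s) * ennreal (?d \<theta>)
       + ennreal C * ennreal (norm (\<theta> - c) powr s * (indicator \<Theta> \<theta> * \<pi> \<theta>))"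
      using split[of \<theta>] d0[of \<theta>] C by (simp flip: ennreal_mult ennreal_plus)
  qed
  also have "\<dots> = ennreal (\<delta> powr s) * (\<integral>\<^sup>+\<theta>. ennreal (?d \<theta>) \<partial>lborel)
       + ennreal C * (\<integral>\<^sup>+\<theta>. ennreal (norm (\<theta> - c) powr s * (indicator \<Theta> \<theta> * \<pi> \<theta>)) \<partial>lborel)"
    by (simp add: nn_integral_add nn_integral_cmult)
  also have "(\<integral>\<^sup>+\<theta>. ennreal (?d \<theta>) \<partial>lborel) = 1"
    using P.emeasure_space_1 by (simp add: posterior_def emeasure_density)
  also have "(\<integral>\<^sup>+\<theta>. ennreal (norm (\<theta> - c) powr s * (indicator \<Theta> \<theta> * \<pi> \<theta>)) \<partial>lborel)
      = (\<integral>\<^sup>+\<theta>\<in>\<Theta>. ennreal (norm (\<theta> - c) powr s * \<pi> \<theta>) \<partial>lborel)"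
    by (rule nn_integral_cong) (simp add: indicator_def)
  also have "ennreal (\<delta> powr s) * 1 + ennreal C * \<dots> \<le> ennreal (\<delta> powr s) + ennreal (E / F / (p * ?v)) * ennreal K"
    using moment Cle by (intro add_mono mult_mono ennreal_leI) auto
  also have "\<dots> = ennreal (\<delta> powr s + K / (p * ?v) * (E / F))"
    using pos EF v by (simp add: mult.commute flip: ennreal_mult ennreal_plus)
  finally show ?thesis .
qed

lemma prior_measurable:
  fixes \<pi> :: "'b::euclidean_space \<Rightarrow> real"
  assumes "open \<Theta>" "is_density (restrict_space lborel \<Theta>) \<pi>"
  shows "(\<lambda>\<theta>. indicator \<Theta> \<theta> * \<pi> \<theta>) \<in> borel_measurable borel"
  using assms borel_measurable_restrict_space_iff[of \<Theta> lborel \<pi>]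
  by (simp add: is_density_def)

text \<open>
Uniformity over \<open>c\<close> is what matters: the centre will be the random estimator, of which only
boundedness is known.
\<close>

lemma prior_centered_moment_le:
  fixes \<pi> :: "'b::euclidean_space \<Rightarrow> real"
  assumes \<Theta>: "open \<Theta>" and prior: "is_density (restrict_space lborel \<Theta>) \<pi>"
    and s: "s \<ge> 0" and moment: "(\<integral>\<^sup>+\<theta>\<in>\<Theta>. ennreal (norm \<theta> powr s * \<pi> \<theta>) \<partial>lborel) < \<infinity>"
  obtains K where "K \<ge> 0"
    "\<And>c. norm c \<le> R \<Longrightarrow> (\<integral>\<^sup>+\<theta>\<in>\<Theta>. ennreal (norm (\<theta> - c) powr s * \<pi> \<theta>) \<partial>lborel) \<le> ennreal K"
proof -
  define m where "m = (\<integral>\<^sup>+\<theta>\<in>\<Theta>. ennreal (norm \<theta> powr s * \<pi> \<theta>) \<partial>lborel)"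
  have m: "m = ennreal (enn2real m)" using moment by (simp add: m_def)
  have [measurable]: "(\<lambda>\<theta>. indicator \<Theta> \<theta> * \<pi> \<theta>) \<in> borel_measurable borel"
    using \<Theta> prior by (rule prior_measurable)
  have nonneg: "0 \<le> indicator \<Theta> \<theta> * \<pi> \<theta>" for \<theta>
    using prior by (auto simp: is_density_def indicator_def space_restrict_space)
  have total: "(\<integral>\<^sup>+\<theta>. ennreal (indicator \<Theta> \<theta> * \<pi> \<theta>) \<partial>lborel) = 1"
  proof -
    have "(\<integral>\<^sup>+\<theta>. ennreal (indicator \<Theta> \<theta> * \<pi> \<theta>) \<partial>lborel) = (\<integral>\<^sup>+\<theta>\<in>\<Theta>. ennreal (\<pi> \<theta>) \<partial>lborel)"
      by (rule nn_integral_cong) (simp add: indicator_def)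
    also have "\<dots> = (\<integral>\<^sup>+\<theta>. ennreal (\<pi> \<theta>) \<partial>restrict_space lborel \<Theta>)"
      using \<Theta> by (intro nn_integral_restrict_space[symmetric]) auto
    finally show ?thesis using prior by (simp add: is_density_def)
  qed
  have weight: "(\<integral>\<^sup>+\<theta>\<in>\<Theta>. ennreal (h \<theta> * \<pi> \<theta>) \<partial>lborel) = (\<integral>\<^sup>+\<theta>. ennreal (h \<theta> * (indicator \<Theta> \<theta> * \<pi> \<theta>)) \<partial>lborel)" for h
    by (rule nn_integral_cong) (simp add: indicator_def)
  show ?thesis
  proof (rule that[of "2 powr s * (enn2real m + R powr s)"])
    show "0 \<le> 2 powr s * (enn2real m + R powr s)" by simp
    fix c :: 'b assume c: "norm c \<le> R"
    have "(\<integral>\<^sup>+\<theta>\<in>\<Theta>. ennreal (norm (\<theta> - c) powr s * \<pi> \<theta>) \<partial>lborel)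
        \<le> (\<integral>\<^sup>+\<theta>. ennreal (2 powr s) * (ennreal (norm \<theta> powr s * (indicator \<Theta> \<theta> * \<pi> \<theta>)) + ennreal (R powr s) * ennreal (indicator \<Theta> \<theta> * \<pi> \<theta>)) \<partial>lborel)"
      unfolding weight
    proof (rule nn_integral_mono)
      fix \<theta> :: 'b
      have "norm (\<theta> - c) powr s \<le> 2 powr s * (norm \<theta> powr s + norm c powr s)"
        using norm_add_powr_le[OF s, of \<theta> "- c"] by simp
      also have "\<dots> \<le> 2 powr s * (norm \<theta> powr s + R powr s)"
        using c s by (intro mult_left_mono add_left_mono powr_mono2) auto
      finally have "norm (\<theta> - c) powr s * (indicator \<Theta> \<theta> * \<pi> \<theta>)
          \<le> 2 powr s * (norm \<theta> powr s + R powr s) * (indicator \<Theta> \<theta> * \<pi> \<theta>)"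
        using nonneg by (rule mult_right_mono)
      also have "\<dots> = 2 powr s * (norm \<theta> powr s * (indicator \<Theta> \<theta> * \<pi> \<theta>) + R powr s * (indicator \<Theta> \<theta> * \<pi> \<theta>))"
        by (simp add: algebra_simps)
      finally have "ennreal (norm (\<theta> - c) powr s * (indicator \<Theta> \<theta> * \<pi> \<theta>))
          \<le> ennreal (2 powr s * (norm \<theta> powr s * (indicator \<Theta> \<theta> * \<pi> \<theta>) + R powr s * (indicator \<Theta> \<theta> * \<pi> \<theta>)))"
        by (rule ennreal_leI)
      then show "ennreal (norm (\<theta> - c) powr s * (indicator \<Theta> \<theta> * \<pi> \<theta>))
          \<le> ennreal (2 powr s) * (ennreal (norm \<theta> powr s * (indicator \<Theta> \<theta> * \<pi> \<theta>)) + ennreal (R powr s) * ennreal (indicator \<Theta> \<theta> * \<pi> \<theta>))"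
        using nonneg[of \<theta>] by (subst ennreal_mult[symmetric], simp, simp, subst ennreal_plus[symmetric], simp, simp, subst ennreal_mult[symmetric]) simp_all
    qed
    also have "\<dots> = ennreal (2 powr s) * ((\<integral>\<^sup>+\<theta>. ennreal (norm \<theta> powr s * (indicator \<Theta> \<theta> * \<pi> \<theta>)) \<partial>lborel)
        + ennreal (R powr s) * (\<integral>\<^sup>+\<theta>. ennreal (indicator \<Theta> \<theta> * \<pi> \<theta>) \<partial>lborel))"
      by (simp add: nn_integral_cmult nn_integral_add)
    also have "\<dots> = ennreal (2 powr s) * (m + ennreal (R powr s))"
      unfolding total weight[symmetric] m_def by simp
    also have "\<dots> = ennreal (2 powr s * (enn2real m + R powr s))"
      by (subst m) (simp add: ennreal_mult)
    finally show "(\<integral>\<^sup>+\<theta>\<in>\<Theta>. ennreal (norm (\<theta> - c) powr s * \<pi> \<theta>) \<partial>lborel) \<le> ennreal (2 powr s * (enn2real m + R powr s))" .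
  qed
qed

lemma likelihood_at_maximiser_pos:
  assumes proper: "proper_posterior \<pi> \<Theta> l a"
    and nonneg: "\<And>\<theta>. \<theta> \<in> \<Theta> \<Longrightarrow> 0 \<le> l \<theta>" and max: "\<And>\<theta>. \<theta> \<in> \<Theta> \<Longrightarrow> l \<theta> \<le> l c"
  shows "l c > 0"
proof (rule ccontr)
  assume "\<not> l c > 0"
  then have "l \<theta> = 0" if "\<theta> \<in> \<Theta>" for \<theta>
    using nonneg[OF that] max[OF that] by linarith
  then have "tempered \<pi> \<Theta> l a = (\<lambda>_. 0)"
    by (auto simp: tempered_def indicator_def)
  then show False using proper by (simp add: proper_posterior_def)
qed

text \<open>
The heart of the proof, and deterministic.  Suppose the log-likelihood lies below its maximum by at least
\<open>n c\<^sub>4 \<bar>\<theta> - c\<bar>\<^sup>2\<close> near the maximiser \<open>c\<close>, by at most \<open>n c\<^sub>3 \<bar>\<theta> - c\<bar>\<^sup>2\<close> there, and by at least \<open>n g\<close> far away.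
Tempering with the exponent \<open>a\<close> only replaces \<open>n\<close> by \<open>a n\<close>.  Hence, with \<open>e = min (c\<^sub>4 \<delta>\<^sup>2) g\<close>, the
tempered likelihood is relatively below \<open>exp (- a n e)\<close> outside the \<open>\<delta>\<close>-ball, and above
\<open>exp (- a n e / 2)\<close> on a ball so small that \<open>c\<^sub>3 t\<^sup>2 \<le> e / 2\<close>.  The posterior moment is therefore at most
\<open>\<delta> powr s\<close> plus a constant times \<open>exp (- a n e / 2)\<close>.  The thresholds \<open>\<eta>\<close> and \<open>b\<^sub>0\<close> do not depend on
\<open>n\<close>, \<open>a\<close>, the likelihood or its maximiser, so the result applies at once to data-dependent
exponents of any order above \<open>1 / n\<close>.
\<close>

lemma tempered_posterior_concentrates_at_maximiser:
  fixes \<pi> :: "'b::euclidean_space \<Rightarrow> real"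
  assumes \<Theta>: "open \<Theta>" "\<theta>\<^sub>0 \<in> \<Theta>"
    and prior: "is_density (restrict_space lborel \<Theta>) \<pi>" and A1: "assumption_A1 \<pi> \<theta>\<^sub>0"
    and moment: "(\<integral>\<^sup>+\<theta>\<in>\<Theta>. ennreal (norm \<theta> powr s * \<pi> \<theta>) \<partial>lborel) < \<infinity>"
    and pos: "s > 0" "r > 0" "g > 0" "c\<^sub>3 > 0" "c\<^sub>4 > 0" "\<epsilon> > 0"
  shows "\<exists>\<eta> b\<^sub>0. \<eta> > 0 \<and> (\<forall>(n::nat) a l c. a > 0 \<longrightarrow> b\<^sub>0 \<le> a * real n \<longrightarrow> proper_posterior \<pi> \<Theta> l a \<longrightarrow>
       (\<forall>\<theta>\<in>\<Theta>. 0 \<le> l \<theta> \<and> l \<theta> \<le> l c) \<longrightarrow> norm (c - \<theta>\<^sub>0) \<le> \<eta> \<longrightarrow>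
       (\<forall>\<theta>\<in>\<Theta> - ball \<theta>\<^sub>0 r. elog (l \<theta>) - elog (l \<theta>\<^sub>0) \<le> ereal (- real n * g)) \<longrightarrow>
       (\<forall>\<theta>\<in>\<Theta> \<inter> ball c (2 * r). ereal (- real n * c\<^sub>3 * (norm (\<theta> - c))\<^sup>2) \<le> elog (l \<theta>) - elog (l c) \<and>
          elog (l \<theta>) - elog (l c) \<le> ereal (- real n * c\<^sub>4 * (norm (\<theta> - c))\<^sup>2)) \<longrightarrow>
       (\<integral>\<^sup>+\<theta>. ennreal (norm (\<theta> - c) powr s) \<partial>posterior \<pi> \<Theta> l a) \<le> ennreal \<epsilon>)"
proof -
  define p where "p = \<pi> \<theta>\<^sub>0 / 2"
  obtain \<rho>\<^sub>1 where \<rho>\<^sub>1: "\<rho>\<^sub>1 > 0" "continuous_on (ball \<theta>\<^sub>0 \<rho>\<^sub>1) \<pi>" "\<forall>\<theta>\<in>ball \<theta>\<^sub>0 \<rho>\<^sub>1. \<pi> \<theta> > 0"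
    using A1 unfolding assumption_A1_def by blast
  then have p: "p > 0" by (simp add: p_def)
  have "isCont \<pi> \<theta>\<^sub>0"
    using \<rho>\<^sub>1 by (simp add: continuous_on_eq_continuous_at)
  then have "\<forall>\<^sub>F \<theta> in nhds \<theta>\<^sub>0. \<theta> \<in> \<Theta> \<and> p < \<pi> \<theta>"
    using p \<Theta> unfolding isCont_def tendsto_at_iff_tendsto_nhds
    by (intro eventually_conj eventually_nhds_in_open order_tendstoD(1)[of \<pi> "\<pi> \<theta>\<^sub>0"]) (auto simp: p_def)
  then obtain \<rho> where \<rho>: "\<rho> > 0" "\<And>\<theta>. dist \<theta> \<theta>\<^sub>0 < \<rho> \<Longrightarrow> \<theta> \<in> \<Theta> \<and> p < \<pi> \<theta>"
    unfolding eventually_nhds_metric by blast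
  \<comment> \<open>\<open>\<eta> \<le> r\<close> makes the two regions cover \<open>\<Theta>\<close>: a point at distance \<open>2 r\<close> from \<open>c\<close> has distance \<open>r\<close> from \<open>\<theta>\<^sub>0\<close>.\<close>
  define \<eta> where "\<eta> = min (\<rho> / 2) r"
  have \<eta>: "\<eta> > 0" "\<eta> \<le> \<rho> / 2" "\<eta> \<le> r" using \<rho> pos by (auto simp: \<eta>_def)
  obtain K where K: "K \<ge> 0" "\<And>c. norm c \<le> norm \<theta>\<^sub>0 + \<eta> \<Longrightarrow>
      (\<integral>\<^sup>+\<theta>\<in>\<Theta>. ennreal (norm (\<theta> - c) powr s * \<pi> \<theta>) \<partial>lborel) \<le> ennreal K"
    by (rule prior_centered_moment_le[OF \<Theta>(1) prior less_imp_le[OF pos(1)] moment, of "norm \<theta>\<^sub>0 + \<eta>"]) blast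
  define \<delta> where "\<delta> = (\<epsilon> / 2) powr (1 / s)"
  have \<delta>: "\<delta> > 0" "\<delta> powr s = \<epsilon> / 2" using pos by (auto simp: \<delta>_def powr_powr)
  define e where "e = min (c\<^sub>4 * \<delta>\<^sup>2) g"
  have e: "e > 0" "e \<le> c\<^sub>4 * \<delta>\<^sup>2" "e \<le> g" using pos \<delta> by (auto simp: e_def)
  define t where "t = min \<eta> (sqrt (e / (2 * c\<^sub>3)))"
  have t: "t > 0" "t \<le> \<eta>" using \<eta> e pos by (auto simp: t_def)
  have t2: "c\<^sub>3 * t\<^sup>2 \<le> e / 2"
  proof -
    have "t\<^sup>2 \<le> (sqrt (e / (2 * c\<^sub>3)))\<^sup>2"
      using t by (intro power_mono) (auto simp: t_def)
    also have "\<dots> = e / (2 * c\<^sub>3)" using e pos by simp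
    finally show ?thesis using pos by (simp add: field_simps)
  qed
  define v where "v = measure lborel (ball (0::'b) t)"
  have vball: "measure lborel (ball c t) = v" for c :: 'b
    using t by (simp add: v_def content_ball)
  define K' where "K' = K / (p * v)"
  \<comment> \<open>chosen so that \<open>x = a n e / 2\<close> satisfies \<open>K' \<le> (\<epsilon> / 2) x\<close>, which suffices since \<open>x \<le> exp x\<close>\<close>
  define b\<^sub>0 where "b\<^sub>0 = 2 / e * (2 * K' / \<epsilon>)"
  show ?thesis
  proof (rule exI[of _ \<eta>], rule exI[of _ b\<^sub>0], rule conjI[OF \<eta>(1)], intro allI impI)
    fix n :: nat and a :: real and l c
    assume a: "a > 0" and b: "b\<^sub>0 \<le> a * real n" and proper: "proper_posterior \<pi> \<Theta> l a"
      and max: "\<forall>\<theta>\<in>\<Theta>. 0 \<le> l \<theta> \<and> l \<theta> \<le> l c" and c: "norm (c - \<theta>\<^sub>0) \<le> \<eta>"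
      and far: "\<forall>\<theta>\<in>\<Theta> - ball \<theta>\<^sub>0 r. elog (l \<theta>) - elog (l \<theta>\<^sub>0) \<le> ereal (- real n * g)"
      and near: "\<forall>\<theta>\<in>\<Theta> \<inter> ball c (2 * r). ereal (- real n * c\<^sub>3 * (norm (\<theta> - c))\<^sup>2) \<le> elog (l \<theta>) - elog (l c) \<and>
          elog (l \<theta>) - elog (l c) \<le> ereal (- real n * c\<^sub>4 * (norm (\<theta> - c))\<^sup>2)"
    have an: "0 \<le> a * real n" using a by simp
    have lc: "l c > 0" using proper max by (intro likelihood_at_maximiser_pos) auto
    have "(\<integral>\<^sup>+\<theta>. ennreal (norm (\<theta> - c) powr s) \<partial>posterior \<pi> \<Theta> l a)
        \<le> ennreal (\<delta> powr s + K / (p * measure lborel (ball c t)) * (exp (- (a * real n * e)) / exp (- (a * real n * (e / 2)))))"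
    proof (rule posterior_moment_le[OF proper prior_measurable[OF \<Theta>(1) prior], where A = "l c powr a"])
      show "0 \<le> \<pi> \<theta>" if "\<theta> \<in> \<Theta>" for \<theta>
        using prior that by (auto simp: is_density_def space_restrict_space)
      show "(\<integral>\<^sup>+\<theta>\<in>\<Theta>. ennreal (norm (\<theta> - c) powr s * \<pi> \<theta>) \<partial>lborel) \<le> ennreal K"
      proof (rule K(2))
        show "norm c \<le> norm \<theta>\<^sub>0 + \<eta>"
          using c norm_triangle_ineq[of "c - \<theta>\<^sub>0" \<theta>\<^sub>0] by simp
      qed
      show "l \<theta> powr a \<le> l c powr a * exp (- (a * real n * e))" if \<theta>: "\<theta> \<in> \<Theta>" "\<delta> \<le> norm (\<theta> - c)" for \<theta>
      proof (cases "\<theta> \<in> ball c (2 * r)")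
        case True
        have "e \<le> c\<^sub>4 * (norm (\<theta> - c))\<^sup>2"
          using \<theta>(2) \<delta> pos by (intro order_trans[OF e(2)] mult_left_mono power_mono) auto
        from mult_left_mono[OF this an] have "a * (- real n * c\<^sub>4 * (norm (\<theta> - c))\<^sup>2) \<le> - (a * real n * e)"
          by (simp add: ac_simps)
        then have "exp (a * (- real n * c\<^sub>4 * (norm (\<theta> - c))\<^sup>2)) \<le> exp (- (a * real n * e))"
          by simp
        from mult_left_mono[OF this, of "l c powr a"]
        have "l c powr a * exp (a * (- real n * c\<^sub>4 * (norm (\<theta> - c))\<^sup>2)) \<le> l c powr a * exp (- (a * real n * e))"
          by simp
        moreover have "l \<theta> powr a \<le> l c powr a * exp (a * (- real n * c\<^sub>4 * (norm (\<theta> - c))\<^sup>2))"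
          using near True \<theta> max a by (intro elog_diff_le_imp_powr_le[of _ "l c"]) auto
        ultimately show ?thesis by linarith
      next
        case False
        have "dist c \<theta> \<le> dist c \<theta>\<^sub>0 + dist \<theta>\<^sub>0 \<theta>" by (rule dist_triangle)
        then have "\<theta> \<notin> ball \<theta>\<^sub>0 r" using False c \<eta>(3) by (simp add: dist_norm)
        then have "l \<theta> powr a \<le> l c powr a * exp (a * (- real n * g))"
          using far \<theta> max a \<Theta>(2) by (intro elog_diff_le_imp_powr_le[of _ "l \<theta>\<^sub>0"]) auto
        moreover have "exp (a * (- real n * g)) \<le> exp (- (a * real n * e))"
          using mult_left_mono[OF e(3) an] by (simp add: ac_simps)
        from mult_left_mono[OF this, of "l c powr a"]
        have "l c powr a * exp (a * (- real n * g)) \<le> l c powr a * exp (- (a * real n * e))"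
          by simp
        ultimately show ?thesis by linarith
      qed
      show "\<theta> \<in> \<Theta> \<and> p \<le> \<pi> \<theta> \<and> l c powr a * exp (- (a * real n * (e / 2))) \<le> l \<theta> powr a" if \<theta>: "\<theta> \<in> ball c t" for \<theta>
      proof -
        have d: "norm (\<theta> - c) < t" using \<theta> by (simp add: dist_norm norm_minus_commute)
        have "dist \<theta> \<theta>\<^sub>0 \<le> dist \<theta> c + dist c \<theta>\<^sub>0" by (rule dist_triangle)
        then have "dist \<theta> \<theta>\<^sub>0 < \<rho>" using d c t(2) \<eta>(2) by (simp add: dist_norm)
        then have \<theta>': "\<theta> \<in> \<Theta>" "p < \<pi> \<theta>" using \<rho>(2) by auto
        have "dist c \<theta> < 2 * r" using d t(2) \<eta>(3) pos by (simp add: dist_norm norm_minus_commute)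
        then have "\<theta> \<in> \<Theta> \<inter> ball c (2 * r)" using \<theta>' by simp
        then have "l c powr a * exp (a * (- real n * c\<^sub>3 * (norm (\<theta> - c))\<^sup>2)) \<le> l \<theta> powr a"
          using near lc a by (intro elog_diff_ge_imp_powr_ge) auto
        moreover have "c\<^sub>3 * (norm (\<theta> - c))\<^sup>2 \<le> e / 2"
          using d pos by (intro order_trans[OF _ t2] mult_left_mono power_mono) auto
        from mult_left_mono[OF this an]
        have "exp (- (a * real n * (e / 2))) \<le> exp (a * (- real n * c\<^sub>3 * (norm (\<theta> - c))\<^sup>2))"
          by (simp add: ac_simps)
        from mult_left_mono[OF this, of "l c powr a"]
        have "l c powr a * exp (- (a * real n * (e / 2))) \<le> l c powr a * exp (a * (- real n * c\<^sub>3 * (norm (\<theta> - c))\<^sup>2))"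
          by simp
        ultimately show ?thesis using \<theta>' by linarith
      qed
    qed (use pos \<delta> t p K lc in auto)
    also have "exp (- (a * real n * e)) / exp (- (a * real n * (e / 2))) = exp (- (a * real n * e / 2))"
      by (simp flip: exp_diff)
    also have "\<delta> powr s + K / (p * measure lborel (ball c t)) * exp (- (a * real n * e / 2)) \<le> \<epsilon>"
    proof -
      define x where "x = a * real n * e / 2"
      have "2 * K' / \<epsilon> \<le> x"
        using mult_right_mono[OF b, of "e / 2"] e by (simp add: b\<^sub>0_def x_def)
      also have "x \<le> exp x" using exp_ge_add_one_self[of x] by linarith
      finally have "K' \<le> \<epsilon> / 2 * exp x" using pos by (simp add: field_simps)
      then have "K' * exp (- x) \<le> \<epsilon> / 2" by (simp add: exp_minus field_simps)
      then have "\<delta> powr s + K' * exp (- x) \<le> \<epsilon>" using \<delta>(2) by linarith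
      then show ?thesis by (simp only: vball K'_def x_def)
    qed
    finally show "(\<integral>\<^sup>+\<theta>. ennreal (norm (\<theta> - c) powr s) \<partial>posterior \<pi> \<Theta> l a) \<le> ennreal \<epsilon>"
      by (simp add: ennreal_leI)
  qed
qed

section \<open>Convergence of the mixed posterior\<close>

theorem theorem3:
  fixes M :: "nat \<Rightarrow> 'w measure"
    and \<X> :: "(real^'d) set"
    and \<nu> :: "(real^'d) measure"
    and X :: "nat \<Rightarrow> 'w \<Rightarrow> nat \<Rightarrow> real^'d"
    and f0 :: "nat \<Rightarrow> (nat \<Rightarrow> real^'d) \<Rightarrow> real"
    and f :: "nat \<Rightarrow> (nat \<Rightarrow> real^'d) \<Rightarrow> real^'p \<Rightarrow> real"
    and \<Theta> :: "(real^'p) set"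
    and \<pi> :: "real^'p \<Rightarrow> real"
    and \<theta>hat :: "nat \<Rightarrow> (nat \<Rightarrow> real^'d) \<Rightarrow> real^'p"
    and \<theta>\<^sub>0 :: "real^'p"
    and V :: "real^'p^'p"
    and s q m \<kappa> L c\<^sub>0 c\<^sub>1 c\<^sub>2 r :: real
    and \<gamma> :: "real \<Rightarrow> real"
    and qn :: "nat \<Rightarrow> 'w \<Rightarrow> real"
    and \<alpha> :: "nat \<Rightarrow> real"
    and \<alpha>hat \<gamma>hat :: "nat \<Rightarrow> (nat \<Rightarrow> real^'d) \<Rightarrow> real"
  defines "lik \<equiv> \<lambda>n \<omega>. f n (X n \<omega>)"
    and "mle \<equiv> \<lambda>n \<omega>. \<theta>hat n (X n \<omega>)"
  assumes reference: "sigma_finite_measure \<nu>" "sets \<nu> = sets (restrict_space borel \<X>)"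
    and prob: "\<And>n. prob_space (M n)"
    and true_density: "\<And>n. n \<ge> 1 \<Longrightarrow> is_density (sample_measure \<nu> n) (f0 n)"
    and sample: "\<And>n. n \<ge> 1 \<Longrightarrow> distributed (M n) (sample_measure \<nu> n) (X n) (\<lambda>x. ennreal (f0 n x))"
    and model: "\<And>n \<theta>. n \<ge> 1 \<Longrightarrow> \<theta> \<in> \<Theta> \<Longrightarrow> is_density (sample_measure \<nu> n) (\<lambda>x. f n x \<theta>)"
    and estimator: "\<And>n. n \<ge> 1 \<Longrightarrow> \<theta>hat n \<in> borel_measurable (sample_measure \<nu> n)"
    and prior: "is_density (restrict_space lborel \<Theta>) \<pi>"
    and proper: "\<And>n. n \<ge> 1 \<Longrightarrow> AE \<omega> in M n. \<forall>a>0. proper_posterior \<pi> \<Theta> (lik n \<omega>) a"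
    and s: "s \<ge> 1"
    and q: "q \<in> {0..1}"
    and qn: "\<And>n. n \<ge> 1 \<Longrightarrow> qn n \<in> borel_measurable (M n)"
      "\<And>n \<omega>. n \<ge> 1 \<Longrightarrow> \<omega> \<in> space (M n) \<Longrightarrow> qn n \<omega> \<in> {0..1}"
      "tends_to_zero_in_prob M (\<lambda>n \<omega>. ereal (qn n \<omega> - q))"
    and \<alpha>: "tempering_sequence \<alpha>"
    and \<alpha>hat: "\<And>n. n \<ge> 1 \<Longrightarrow> \<alpha>hat n \<in> borel_measurable (sample_measure \<nu> n)"
      "\<And>n x. n \<ge> 1 \<Longrightarrow> x \<in> space (sample_measure \<nu> n) \<Longrightarrow> \<alpha>hat n x > 0"
      "\<And>\<epsilon>. \<epsilon> > 0 \<Longrightarrow> with_prob_tending_to_one M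
         (\<lambda>n \<omega>. 1 - \<epsilon> < \<alpha>hat n (X n \<omega>) / \<alpha> n \<and> \<alpha>hat n (X n \<omega>) / \<alpha> n < 1 + \<epsilon>)"
    and \<gamma>hat: "\<And>n. n \<ge> 1 \<Longrightarrow> \<gamma>hat n \<in> borel_measurable (sample_measure \<nu> n)"
      "\<And>n x. n \<ge> 1 \<Longrightarrow> x \<in> space (sample_measure \<nu> n) \<Longrightarrow> \<gamma>hat n x > 0"
      "\<And>B. B > 0 \<Longrightarrow> with_prob_tending_to_one M (\<lambda>n \<omega>. \<gamma>hat n (X n \<omega>) > B)"
    and A0: "assumption_A0 M \<Theta> lik mle \<theta>\<^sub>0"
    and A1: "assumption_A1 \<pi> \<theta>\<^sub>0"
    and A2: "assumption_A2 M \<Theta> lik mle \<theta>\<^sub>0 V"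
    and A3: "assumption_A3 M \<pi> \<Theta> lik \<theta>\<^sub>0"
    and A3': "assumption_A3' M \<Theta> lik mle"
    and C1: "condition_1 M \<Theta> lik \<theta>\<^sub>0 L c\<^sub>0 c\<^sub>1 c\<^sub>2 r \<gamma>"
    and C2: "condition_2 M \<Theta> lik mle r"
    and bounded_prior: "\<kappa> > 0" "\<And>\<theta>. \<theta> \<in> \<Theta> \<Longrightarrow> \<pi> \<theta> \<le> \<kappa>"
    and continuous_at_mle: "\<And>n. n \<ge> 1 \<Longrightarrow> AE \<omega> in M n. isCont (lik n \<omega>) (mle n \<omega>)"
    and moment_s: "(\<integral>\<^sup>+\<theta>\<in>\<Theta>. ennreal (norm \<theta> powr s * \<pi> \<theta>) \<partial>lborel) < \<infinity>"
    and moment_m: "m > s" "(\<integral>\<^sup>+\<theta>\<in>\<Theta>. ennreal (norm \<theta> powr m * \<pi> \<theta>) \<partial>lborel) < \<infinity>"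
  shows "tends_to_zero_in_prob M (\<lambda>n \<omega>. wasserstein s
    (mixture (qn n \<omega>) (posterior \<pi> \<Theta> (lik n \<omega>) (\<alpha>hat n (X n \<omega>)))
                      (posterior \<pi> \<Theta> (lik n \<omega>) (\<gamma>hat n (X n \<omega>))))
    (mixture q (mv_normal (mle n \<omega>) ((1 / (\<alpha> n * real n)) *\<^sub>R matrix_inv V))
               (return borel (mle n \<omega>))))"
proof -
  define A where "A n \<omega> = posterior \<pi> \<Theta> (lik n \<omega>) (\<alpha>hat n (X n \<omega>))" for n \<omega>
  define G where "G n \<omega> = posterior \<pi> \<Theta> (lik n \<omega>) (\<gamma>hat n (X n \<omega>))" for n \<omega>
  define N where "N n \<omega> = mv_normal (mle n \<omega>) ((1 / (\<alpha> n * real n)) *\<^sub>R matrix_inv V)" for n \<omega>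
  have s0: "s > 0" using s by simp
  have \<Theta>: "open \<Theta>" "\<theta>\<^sub>0 \<in> \<Theta>" and mle: "is_unique_MLE M \<Theta> lik mle"
    and consistent: "tends_to_zero_in_prob M (\<lambda>n \<omega>. ereal (norm (mle n \<omega> - \<theta>\<^sub>0)))"
    using A0 by (auto simp: assumption_A0_def)
  have V: "positive_definite V" using A2 by (simp add: assumption_A2_def)
  have \<alpha>pos: "\<alpha> n > 0" if "n \<ge> 1" for n
    using \<alpha> that by (simp add: tempering_sequence_def)
  have \<alpha>0: "\<alpha> \<longlonglongrightarrow> 0" and \<alpha>n: "(\<lambda>n. 1 / (\<alpha> n * real n)) \<longlonglongrightarrow> 0"
    using \<alpha> by (auto simp: tempering_sequence_def mult.commute)
  have \<pi>0: "0 \<le> \<pi> \<theta>" if "\<theta> \<in> \<Theta>" for \<theta>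
    using prior that by (auto simp: is_density_def space_restrict_space)
  have Xspace: "X n \<omega> \<in> space (sample_measure \<nu> n)" if "n \<ge> 1" "\<omega> \<in> space (M n)" for n \<omega>
    using measurable_space[OF distributed_measurable[OF sample[OF that(1)]] that(2)] .
  have lik0: "0 \<le> lik n \<omega> \<theta>" if "n \<ge> 1" "\<omega> \<in> space (M n)" "\<theta> \<in> \<Theta>" for n \<omega> \<theta>
    using model[OF that(1,3)] Xspace[OF that(1,2)] by (simp add: is_density_def lik_def)
  have c: "L > 0" "c\<^sub>0 > 0" "c\<^sub>1 > 0" "r > exp (c\<^sub>2 / c\<^sub>0) / c\<^sub>1"
    and \<gamma>: "\<And>v. v \<ge> r \<Longrightarrow> \<gamma> v \<ge> c\<^sub>0 * ln (1 + c\<^sub>1 * v) - c\<^sub>2"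
    and far: "with_prob_tending_to_one M (\<lambda>n \<omega>. \<forall>\<theta>\<in>\<Theta> - ball \<theta>\<^sub>0 r.
        elog (lik n \<omega> \<theta>) - elog (lik n \<omega> \<theta>\<^sub>0) \<le> ereal (- L * real n * \<gamma> (norm (\<theta> - \<theta>\<^sub>0))))"
    using C1 unfolding condition_1_def by blast+
  have r: "r > 0" using c by (meson divide_pos_pos exp_gt_zero less_trans)
  \<comment> \<open>The lower bound on \<open>r\<close> says exactly that the logarithmic bound on \<open>\<gamma>\<close> is already positive at \<open>r\<close>;
    being increasing, it bounds the decay rate from below on the whole far region.\<close>
  define g where "g = L * (c\<^sub>0 * ln (1 + c\<^sub>1 * r) - c\<^sub>2)"
  have g: "g > 0"
  proof -
    have "exp (c\<^sub>2 / c\<^sub>0) < 1 + c\<^sub>1 * r" using c by (simp add: field_simps)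
    then have "ln (exp (c\<^sub>2 / c\<^sub>0)) < ln (1 + c\<^sub>1 * r)"
      by (subst ln_less_cancel_iff) (auto intro: less_trans[OF exp_gt_zero])
    then show ?thesis using c by (simp add: g_def field_simps)
  qed
  have far_rate: "- L * real n * \<gamma> v \<le> - real n * g" if "v \<ge> r" for n v
  proof -
    have "c\<^sub>0 * ln (1 + c\<^sub>1 * r) \<le> c\<^sub>0 * ln (1 + c\<^sub>1 * v)"
      using that c r by (intro mult_left_mono ln_mono) (auto intro: add_pos_pos)
    then have "c\<^sub>0 * ln (1 + c\<^sub>1 * r) - c\<^sub>2 \<le> \<gamma> v"
      using \<gamma>[OF that] by linarith
    then have "g \<le> L * \<gamma> v"
      unfolding g_def using c by (intro mult_left_mono) auto
    from mult_left_mono[OF this, of "real n"] show ?thesis by (simp add: ac_simps)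
  qed
  obtain c\<^sub>3 c\<^sub>4 where c34: "c\<^sub>3 > 0" "c\<^sub>4 > 0"
    and near: "with_prob_tending_to_one M (\<lambda>n \<omega>. \<forall>\<theta>\<in>\<Theta> \<inter> ball (mle n \<omega>) (2 * r).
        ereal (- real n * c\<^sub>3 * (norm (\<theta> - mle n \<omega>))\<^sup>2) \<le> elog (lik n \<omega> \<theta>) - elog (lik n \<omega> (mle n \<omega>)) \<and>
        elog (lik n \<omega> \<theta>) - elog (lik n \<omega> (mle n \<omega>)) \<le> ereal (- real n * c\<^sub>4 * (norm (\<theta> - mle n \<omega>))\<^sup>2))"
    using C2 unfolding condition_2_def by blast
  obtain K where normal: "\<And>\<mu> c. c > 0 \<Longrightarrow> prob_space (mv_normal \<mu> (c *\<^sub>R matrix_inv V))"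
    and normal_moment: "\<And>\<mu> c. c > 0 \<Longrightarrow>
      (\<integral>\<^sup>+x. ennreal (norm (x - \<mu>) powr s) \<partial>mv_normal \<mu> (c *\<^sub>R matrix_inv V)) \<le> ennreal (K * sqrt c powr s)"
    by (rule mv_normal_scaled_covariance[OF V less_imp_le[OF s0]]) blast
  have "with_prob_tending_to_one M (\<lambda>n \<omega>. \<bar>wasserstein s (mixture (qn n \<omega>) (A n \<omega>) (G n \<omega>))
      (mixture q (N n \<omega>) (return borel (mle n \<omega>)))\<bar> \<le> ereal \<epsilon>)" if \<epsilon>: "\<epsilon> > 0" for \<epsilon>
  proof -
    \<comment> \<open>Each mixture may contribute \<open>D\<close>, and \<open>2 powr s * (D + D) = \<epsilon> powr s\<close>.\<close>
    define D where "D = \<epsilon> powr s / (2 * 2 powr s)"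
    have D: "D > 0" using \<epsilon> by (simp add: D_def)
    obtain \<eta> b\<^sub>0 where \<eta>: "\<eta> > 0" and concentrate:
      "\<forall>(n::nat) a l c. a > 0 \<longrightarrow> b\<^sub>0 \<le> a * real n \<longrightarrow> proper_posterior \<pi> \<Theta> l a \<longrightarrow>
       (\<forall>\<theta>\<in>\<Theta>. 0 \<le> l \<theta> \<and> l \<theta> \<le> l c) \<longrightarrow> norm (c - \<theta>\<^sub>0) \<le> \<eta> \<longrightarrow>
       (\<forall>\<theta>\<in>\<Theta> - ball \<theta>\<^sub>0 r. elog (l \<theta>) - elog (l \<theta>\<^sub>0) \<le> ereal (- real n * g)) \<longrightarrow>
       (\<forall>\<theta>\<in>\<Theta> \<inter> ball c (2 * r). ereal (- real n * c\<^sub>3 * (norm (\<theta> - c))\<^sup>2) \<le> elog (l \<theta>) - elog (l c) \<and>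
          elog (l \<theta>) - elog (l c) \<le> ereal (- real n * c\<^sub>4 * (norm (\<theta> - c))\<^sup>2)) \<longrightarrow>
       (\<integral>\<^sup>+\<theta>. ennreal (norm (\<theta> - c) powr s) \<partial>posterior \<pi> \<Theta> l a) \<le> ennreal D"
      using tempered_posterior_concentrates_at_maximiser[OF \<Theta> prior A1 moment_s s0 r g c34 D]
      by (elim exE conjE) (rule that)
    have close: "with_prob_tending_to_one M (\<lambda>n \<omega>. \<bar>ereal (norm (mle n \<omega> - \<theta>\<^sub>0))\<bar> \<le> ereal \<eta>)"
      using consistent \<eta> unfolding tends_to_zero_in_prob_iff by blast
    have argmax: "with_prob_tending_to_one M (\<lambda>n \<omega>. \<forall>\<theta>. is_arg_max (lik n \<omega>) (\<lambda>t. t \<in> \<Theta>) \<theta> \<longleftrightarrow> \<theta> = mle n \<omega>)"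
      using mle unfolding is_unique_MLE_def by (intro with_prob_tending_to_one_AE) blast
    have all_proper: "with_prob_tending_to_one M (\<lambda>n \<omega>. \<forall>a>0. proper_posterior \<pi> \<Theta> (lik n \<omega>) a)"
      using proper by (rule with_prob_tending_to_one_AE)
    \<comment> \<open>On this event both tempering exponents exceed \<open>\<alpha> n / 2\<close> for large \<open>n\<close>, the second because it
      exceeds 1 while \<open>\<alpha> n\<close> tends to 0.\<close>
    have event: "with_prob_tending_to_one M (\<lambda>n \<omega>.
        (\<forall>\<theta>\<in>\<Theta> - ball \<theta>\<^sub>0 r. elog (lik n \<omega> \<theta>) - elog (lik n \<omega> \<theta>\<^sub>0) \<le> ereal (- L * real n * \<gamma> (norm (\<theta> - \<theta>\<^sub>0)))) \<and>
        (\<forall>\<theta>\<in>\<Theta> \<inter> ball (mle n \<omega>) (2 * r).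
          ereal (- real n * c\<^sub>3 * (norm (\<theta> - mle n \<omega>))\<^sup>2) \<le> elog (lik n \<omega> \<theta>) - elog (lik n \<omega> (mle n \<omega>)) \<and>
          elog (lik n \<omega> \<theta>) - elog (lik n \<omega> (mle n \<omega>)) \<le> ereal (- real n * c\<^sub>4 * (norm (\<theta> - mle n \<omega>))\<^sup>2)) \<and>
        \<bar>ereal (norm (mle n \<omega> - \<theta>\<^sub>0))\<bar> \<le> ereal \<eta> \<and>
        (1 - 1/2 < \<alpha>hat n (X n \<omega>) / \<alpha> n \<and> \<alpha>hat n (X n \<omega>) / \<alpha> n < 1 + 1/2) \<and>
        \<gamma>hat n (X n \<omega>) > 1 \<and>
        (\<forall>\<theta>. is_arg_max (lik n \<omega>) (\<lambda>t. t \<in> \<Theta>) \<theta> \<longleftrightarrow> \<theta> = mle n \<omega>) \<and>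
        (\<forall>a>0. proper_posterior \<pi> \<Theta> (lik n \<omega>) a))"
      by (rule with_prob_tending_to_one_conj far near close \<alpha>hat(3) \<gamma>hat(3) argmax all_proper | simp)+
    have ev_b: "\<forall>\<^sub>F n in sequentially. b\<^sub>0 \<le> \<alpha> n / 2 * real n"
    proof -
      have "\<forall>\<^sub>F n in sequentially. 1 / (\<alpha> n * real n) < 1 / (2 * \<bar>b\<^sub>0\<bar> + 1)"
        using \<alpha>n by (rule order_tendstoD) auto
      then show ?thesis
        using eventually_ge_at_top[of 1]
      proof eventually_elim
        case (elim n)
        then have "\<alpha> n * real n > 0" using \<alpha>pos by simp
        with elim(1) have "2 * \<bar>b\<^sub>0\<bar> + 1 < \<alpha> n * real n" by (simp add: field_simps)
        then show ?case by linarith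
      qed
    qed
    have ev_\<alpha>: "\<forall>\<^sub>F n in sequentially. \<alpha> n < 1"
      using \<alpha>0 by (rule order_tendstoD) simp
    have ev_N: "\<forall>\<^sub>F n in sequentially. K * sqrt (1 / (\<alpha> n * real n)) powr s < D"
    proof -
      have "(\<lambda>n. K * sqrt (1 / (\<alpha> n * real n)) powr s) \<longlonglongrightarrow> K * sqrt 0 powr s"
      proof (intro tendsto_mult[OF tendsto_const] tendsto_powr'[OF tendsto_real_sqrt[OF \<alpha>n] tendsto_const] disjI2 conjI)
        show "\<forall>\<^sub>F n in sequentially. 0 \<le> sqrt (1 / (\<alpha> n * real n))"
          using eventually_ge_at_top[of 1] by eventually_elim (use \<alpha>pos in \<open>auto intro: less_imp_le\<close>)
      qed (use s in auto)
      then show ?thesis using D s by (intro order_tendstoD(2)) auto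
    qed
    show ?thesis
    proof (rule with_prob_tending_to_one_mono[OF event], use ev_b ev_\<alpha> ev_N eventually_ge_at_top[of 1] in eventually_elim, intro ballI impI, elim conjE)
      fix n \<omega>
      assume b: "b\<^sub>0 \<le> \<alpha> n / 2 * real n" and \<alpha>1: "\<alpha> n < 1" and small: "K * sqrt (1 / (\<alpha> n * real n)) powr s < D"
        and n: "1 \<le> n" and \<omega>: "\<omega> \<in> space (M n)"
        and far: "\<forall>\<theta>\<in>\<Theta> - ball \<theta>\<^sub>0 r. elog (lik n \<omega> \<theta>) - elog (lik n \<omega> \<theta>\<^sub>0) \<le> ereal (- L * real n * \<gamma> (norm (\<theta> - \<theta>\<^sub>0)))"
        and near: "\<forall>\<theta>\<in>\<Theta> \<inter> ball (mle n \<omega>) (2 * r).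
          ereal (- real n * c\<^sub>3 * (norm (\<theta> - mle n \<omega>))\<^sup>2) \<le> elog (lik n \<omega> \<theta>) - elog (lik n \<omega> (mle n \<omega>)) \<and>
          elog (lik n \<omega> \<theta>) - elog (lik n \<omega> (mle n \<omega>)) \<le> ereal (- real n * c\<^sub>4 * (norm (\<theta> - mle n \<omega>))\<^sup>2)"
        and close: "\<bar>ereal (norm (mle n \<omega> - \<theta>\<^sub>0))\<bar> \<le> ereal \<eta>"
        and ahat: "1 - 1/2 < \<alpha>hat n (X n \<omega>) / \<alpha> n" and ghat: "\<gamma>hat n (X n \<omega>) > 1"
        and argmax: "\<forall>\<theta>. is_arg_max (lik n \<omega>) (\<lambda>t. t \<in> \<Theta>) \<theta> \<longleftrightarrow> \<theta> = mle n \<omega>"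
        and proper: "\<forall>a>0. proper_posterior \<pi> \<Theta> (lik n \<omega>) a"
      have ahat': "\<alpha> n / 2 < \<alpha>hat n (X n \<omega>)"
        using ahat \<alpha>pos[OF n] by (simp add: field_simps)
      have max: "\<forall>\<theta>\<in>\<Theta>. 0 \<le> lik n \<omega> \<theta> \<and> lik n \<omega> \<theta> \<le> lik n \<omega> (mle n \<omega>)"
        using argmax[THEN spec, of "mle n \<omega>"] lik0[OF n \<omega>] by (auto simp: is_arg_max_def not_less)
      have far': "\<forall>\<theta>\<in>\<Theta> - ball \<theta>\<^sub>0 r. elog (lik n \<omega> \<theta>) - elog (lik n \<omega> \<theta>\<^sub>0) \<le> ereal (- real n * g)"
      proof
        fix \<theta> assume \<theta>: "\<theta> \<in> \<Theta> - ball \<theta>\<^sub>0 r"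
        then have "r \<le> norm (\<theta> - \<theta>\<^sub>0)" by (simp add: dist_norm norm_minus_commute)
        from far_rate[OF this, of n] bspec[OF far \<theta>]
        show "elog (lik n \<omega> \<theta>) - elog (lik n \<omega> \<theta>\<^sub>0) \<le> ereal (- real n * g)"
          by (meson ereal_less_eq(3) order_trans)
      qed
      have post: "prob_space (posterior \<pi> \<Theta> (lik n \<omega>) a)"
        "(\<integral>\<^sup>+\<theta>. ennreal (norm (\<theta> - mle n \<omega>) powr s) \<partial>posterior \<pi> \<Theta> (lik n \<omega>) a) \<le> ennreal D"
        if a: "\<alpha> n / 2 < a" for a
      proof -
        have a0: "a > 0" using a \<alpha>pos[OF n] by linarith
        have "b\<^sub>0 \<le> a * real n"
          using b mult_right_mono[of "\<alpha> n / 2" a "real n"] a by linarith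
        then show "(\<integral>\<^sup>+\<theta>. ennreal (norm (\<theta> - mle n \<omega>) powr s) \<partial>posterior \<pi> \<Theta> (lik n \<omega>) a) \<le> ennreal D"
          using a0 proper max close far' near by (intro concentrate[rule_format]) auto
        show "prob_space (posterior \<pi> \<Theta> (lik n \<omega>) a)"
          using proper a0 \<pi>0 by (intro prob_space_posterior) auto
      qed
      have A: "prob_space (A n \<omega>)" "(\<integral>\<^sup>+\<theta>. ennreal (norm (\<theta> - mle n \<omega>) powr s) \<partial>A n \<omega>) \<le> ennreal D"
        unfolding A_def using ahat' by (rule post)+
      have G: "prob_space (G n \<omega>)" "(\<integral>\<^sup>+\<theta>. ennreal (norm (\<theta> - mle n \<omega>) powr s) \<partial>G n \<omega>) \<le> ennreal D"
        unfolding G_def using ghat \<alpha>1 by (auto intro!: post)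
      have t: "1 / (\<alpha> n * real n) > 0" using \<alpha>pos[OF n] n by simp
      have N: "prob_space (N n \<omega>)" "(\<integral>\<^sup>+\<theta>. ennreal (norm (\<theta> - mle n \<omega>) powr s) \<partial>N n \<omega>) \<le> ennreal D"
        unfolding N_def using normal[OF t] order_trans[OF normal_moment[OF t] ennreal_leI[OF less_imp_le[OF small]]]
        by blast+
      have sets: "sets (A n \<omega>) = sets borel" "sets (G n \<omega>) = sets borel" "sets (N n \<omega>) = sets borel"
        by (simp_all add: A_def G_def N_def posterior_def mv_normal_def)
      have meas: "(\<lambda>\<theta>. ennreal (norm (\<theta> - mle n \<omega>) powr s)) \<in> borel_measurable \<mu>" if "sets \<mu> = sets borel" for \<mu>
        unfolding measurable_cong_sets[OF that refl] by measurable
      have qn01: "0 \<le> qn n \<omega>" "qn n \<omega> \<le> 1" using qn(2)[OF n \<omega>] by auto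
      have q01: "0 \<le> q" "q \<le> 1" using q by auto
      have ret: "(\<integral>\<^sup>+\<theta>. ennreal (norm (\<theta> - mle n \<omega>) powr s) \<partial>return borel (mle n \<omega>)) \<le> ennreal D"
        by (subst nn_integral_return) auto
      show "\<bar>wasserstein s (mixture (qn n \<omega>) (A n \<omega>) (G n \<omega>)) (mixture q (N n \<omega>) (return borel (mle n \<omega>)))\<bar> \<le> ereal \<epsilon>"
      proof (rule wasserstein_le_centered_moments[where c = "mle n \<omega>"])
        show "prob_space (mixture (qn n \<omega>) (A n \<omega>) (G n \<omega>))"
          using A G sets qn01 by (intro prob_space_mixture) auto
        show "prob_space (mixture q (N n \<omega>) (return borel (mle n \<omega>)))"
          using N sets q01 by (intro prob_space_mixture prob_space_return) auto
        have "(\<integral>\<^sup>+\<theta>. ennreal (norm (\<theta> - mle n \<omega>) powr s) \<partial>mixture (qn n \<omega>) (A n \<omega>) (G n \<omega>)) \<le> ennreal D"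
          using A G D qn01 sets by (subst nn_integral_mixture) (auto intro!: meas ennreal_convex_combination_le)
        moreover have "(\<integral>\<^sup>+\<theta>. ennreal (norm (\<theta> - mle n \<omega>) powr s) \<partial>mixture q (N n \<omega>) (return borel (mle n \<omega>))) \<le> ennreal D"
          using N ret D q01 sets by (subst nn_integral_mixture) (auto intro!: meas ennreal_convex_combination_le)
        ultimately have "ennreal (2 powr s) *
            ((\<integral>\<^sup>+\<theta>. ennreal (norm (\<theta> - mle n \<omega>) powr s) \<partial>mixture (qn n \<omega>) (A n \<omega>) (G n \<omega>)) +
             (\<integral>\<^sup>+\<theta>. ennreal (norm (\<theta> - mle n \<omega>) powr s) \<partial>mixture q (N n \<omega>) (return borel (mle n \<omega>))))
            \<le> ennreal (2 powr s) * (ennreal D + ennreal D)"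
          by (intro mult_left_mono add_mono) auto
        also have "\<dots> = ennreal (2 powr s * (D + D))"
          using D by (subst ennreal_mult) (auto simp flip: ennreal_plus)
        also have "2 powr s * (D + D) = \<epsilon> powr s"
          by (simp add: D_def)
        finally show "ennreal (2 powr s) *
            ((\<integral>\<^sup>+\<theta>. ennreal (norm (\<theta> - mle n \<omega>) powr s) \<partial>mixture (qn n \<omega>) (A n \<omega>) (G n \<omega>)) +
             (\<integral>\<^sup>+\<theta>. ennreal (norm (\<theta> - mle n \<omega>) powr s) \<partial>mixture q (N n \<omega>) (return borel (mle n \<omega>))))
            \<le> ennreal (\<epsilon> powr s)" .
      qed (use sets s \<epsilon> in auto)
    qed
  qed
  then show ?thesis
    by (simp add: tends_to_zero_in_prob_iff A_def G_def N_def)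
qed

end
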